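(* Let $\eta_\infty=\inf_{R\in\mathscr R_{(s,t)}}\max_{1\le\ell\le m}\|F(x_\ell)-R(x_\ell)\|_{\mathrm F}^2$. Then weak duality holds: $$\sup_{\boldsymbol w\ge 0,\ \boldsymbol w\neq 0}d(\boldsymbol w)=\max_{\boldsymbol w\in\mathcal S}d(\boldsymbol w)\le\eta_\infty,$$ where $\boldsymbol w=[w_1,\dots,w_m]^{\mathrm T}\in\mathbb R^m$, $\mathcal S=\{\boldsymbol w\in\mathbb R^m:\boldsymbol w\ge0,\ \sum_{\ell=1}^m w_\ell=1\}$ is the probability simplex, and the dual function is $$d(\boldsymbol w)=\min_{\substack{p_{ij}\in\mathbb P_{n_{ij}},\ q\in\mathbb P_d\\ \sum_{\ell=1}^m w_\ell|q(x_\ell)|^2=1}}\ \sum_{\ell=1}^m w_\ell\Big(\sum_{i=1}^s\sum_{j=1}^t|f_{ij}(x_\ell)q(x_\ell)-p_{ij}(x_\ell)|^2\Big)=\min_{\substack{\boldsymbol a\in\mathbb C^n,\ \boldsymbol b\in\mathbb C^{d+1}\\ \|\sqrt W\,\mathbf\Phi\boldsymbol b\|_2=1}}\Big\|\sqrt{\boldsymbol W_\otimes}\,(\boldsymbol F\mathbf\Phi\boldsymbol b-\mathbf\Theta\boldsymbol a)\Big\|_2^2 .$$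
   Context: $s,t\ge1$ and $d,n_{ij}\ge0$ are given integers; $\mathbb P_n$ is the set of complex polynomials of degree at most $n$; $\mathcal X=\{x_\ell\}_{\ell=1}^m\subset\mathbb C$ are distinct nodes with $m\ge\max_{i,j}\{n_{ij}+d+2\}$; $F(x_\ell)=[f_{ij}(x_\ell)]\in\mathbb C^{s\times t}$ are given data; $\|\cdot\|_{\mathrm F}$ is the Frobenius norm. $\mathscr R_{(s,t)}$ is the set of $R=[r_{ij}]$ of size $s\times t$ with $r_{ij}=p_{ij}/q$, $p_{ij}\in\mathbb P_{n_{ij}}$, common denominator $0\not\equiv q\in\mathbb P_d$. If $q$ vanishes at a node, values of $R$ there are understood after cancelling common zeros; if a pole remains at a node the error there is $+\infty$. Matrix notation: $g=st$, $n=\sum_{i,j}(n_{ij}+1)$. For each $(i,j)$ let $\{\psi_0,\dots,\psi_{n_{ij}}\}$ be a basis of $\mathbb P_{n_{ij}}$ and $\{\phi_0,\dots,\phi_d\}$ a basis of $\mathbb P_d$ (e.g. monomials). $\mathbf\Psi_{ij}\in\mathbb C^{m\times(n_{ij}+1)}$ has $(\ell,k)$ entry $\psi_{k-1}(x_\ell)$ and $\mathbf\Phi\in\mathbb C^{m\times(d+1)}$ has $(\ell,k)$ entry $\phi_{k-1}(x_\ell)$. $F_{ij}=\mathrm{diag}(f_{ij}(x_1),\dots,f_{ij}(x_m))$. With the index pairs ordered column-wise, $(1,1),\dots,(s,1),(1,2),\dots,(s,t)$, $\boldsymbol F\in\mathbb C^{gm\times m}$ is the vertical stack of the $F_{ij}$,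 $\mathbf\Theta\in\mathbb C^{gm\times n}$ is block diagonal with diagonal blocks $\mathbf\Psi_{ij}$, and $\boldsymbol a\in\mathbb C^n$ is the stack of the coefficient vectors $\boldsymbol a_{ij}\in\mathbb C^{n_{ij}+1}$ of the $p_{ij}$; $\boldsymbol b$ is the coefficient vector of $q$. $W=\mathrm{diag}(\boldsymbol w)$ and $\boldsymbol W_\otimes=I_g\otimes W$. *)

theory Defs
  imports
    "HOL-Library.Extended_Real"
    "HOL-Analysis.L2_Norm"
    "HOL-Computational_Algebra.Computational_Algebra"
    "HOL-Computational_Algebra.Field_as_Ring"
    "Jordan_Normal_Form.Matrix"
begin

(* All indices are zero-based: nodes x l with l < m, matrix entries (i,j) with i < s, j < t.
   Vectors and matrices are those of Jordan_Normal_Form, whose dimensions are terms. *)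

definition attained_min :: "'a::ord set \<Rightarrow> 'a \<Rightarrow> bool" where
  "attained_min A v \<longleftrightarrow> v \<in> A \<and> (\<forall>u\<in>A. v \<le> u)"

definition attained_max :: "'a::ord set \<Rightarrow> 'a \<Rightarrow> bool" where
  "attained_max A v \<longleftrightarrow> v \<in> A \<and> (\<forall>u\<in>A. u \<le> v)"

definition vec_norm2 :: "complex vec \<Rightarrow> real" where
  "vec_norm2 v = L2_set (\<lambda>i. cmod (v $ i)) {..<dim_vec v}"

definition frobenius_norm :: "complex mat \<Rightarrow> real" where
  "frobenius_norm A = L2_set (\<lambda>(i,j). cmod (A $$ (i,j))) ({..<dim_row A} \<times> {..<dim_col A})"

definition polys_le :: "nat \<Rightarrow> complex poly set" where
  "polys_le k = {p. degree p \<le> k}"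

global_interpretation poly_vs: Vector_Spaces.vector_space "Polynomial.smult :: complex \<Rightarrow> complex poly \<Rightarrow> complex poly"
  by standard (simp_all add: smult_add_right smult_add_left)

definition poly_basis :: "nat \<Rightarrow> (nat \<Rightarrow> complex poly) \<Rightarrow> bool" where
  "poly_basis k \<psi> \<longleftrightarrow>
     inj_on \<psi> {..k} \<and> \<not> poly_vs.dependent (\<psi> ` {..k}) \<and> poly_vs.span (\<psi> ` {..k}) = polys_le k"


(* Rational functions are elements of the fraction field of complex poly; quot_of_fract yields
   the coprime numerator/denominator pair, i.e. the quotient after cancelling common zeros. *)

definition rat_pole :: "complex poly fract \<Rightarrow> complex \<Rightarrow> bool" where
  "rat_pole r z \<longleftrightarrow> poly (snd (quot_of_fract r)) z = 0"

definition rat_value :: "complex poly fract \<Rightarrow> complex \<Rightarrow> complex" where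
  "rat_value r z = poly (fst (quot_of_fract r)) z / poly (snd (quot_of_fract r)) z"

definition rat_matrices :: "nat \<Rightarrow> nat \<Rightarrow> (nat \<Rightarrow> nat \<Rightarrow> nat) \<Rightarrow> nat \<Rightarrow> complex poly fract mat set" where
  "rat_matrices s t n d =
     {Matrix.mat s t (\<lambda>(i,j). to_fract (p i j) / to_fract q) | p q.
        (\<forall>i<s. \<forall>j<t. p i j \<in> polys_le (n i j)) \<and> q \<in> polys_le d \<and> q \<noteq> 0}"

definition sq_error :: "(complex \<Rightarrow> complex mat) \<Rightarrow> complex poly fract mat \<Rightarrow> complex \<Rightarrow> ereal" where
  "sq_error F R z =
     (if \<exists>i<dim_row R. \<exists>j<dim_col R. rat_pole (R $$ (i,j)) z then \<infinity>
      else ereal ((frobenius_norm (F z - map_mat (\<lambda>r. rat_value r z) R))\<^sup>2))"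

definition eta_inf ::
  "nat \<Rightarrow> nat \<Rightarrow> (nat \<Rightarrow> nat \<Rightarrow> nat) \<Rightarrow> nat \<Rightarrow> nat \<Rightarrow> (nat \<Rightarrow> complex) \<Rightarrow> (complex \<Rightarrow> complex mat) \<Rightarrow> ereal" where
  "eta_inf s t n d m x F =
     (INF R \<in> rat_matrices s t n d. Max ((\<lambda>l. sq_error F R (x l)) ` {..<m}))"


definition dual_values ::
  "nat \<Rightarrow> nat \<Rightarrow> (nat \<Rightarrow> nat \<Rightarrow> nat) \<Rightarrow> nat \<Rightarrow> nat \<Rightarrow> (nat \<Rightarrow> complex) \<Rightarrow> (complex \<Rightarrow> complex mat)
   \<Rightarrow> real vec \<Rightarrow> real set" where
  "dual_values s t n d m x F w =
     {\<Sum>l<m. w $ l * (\<Sum>i<s. \<Sum>j<t. (cmod (F (x l) $$ (i,j) * poly q (x l) - poly (p i j) (x l)))\<^sup>2) | p q.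
        (\<forall>i<s. \<forall>j<t. p i j \<in> polys_le (n i j)) \<and> q \<in> polys_le d \<and>
        (\<Sum>l<m. w $ l * (cmod (poly q (x l)))\<^sup>2) = 1}"

definition dual_fun ::
  "nat \<Rightarrow> nat \<Rightarrow> (nat \<Rightarrow> nat \<Rightarrow> nat) \<Rightarrow> nat \<Rightarrow> nat \<Rightarrow> (nat \<Rightarrow> complex) \<Rightarrow> (complex \<Rightarrow> complex mat)
   \<Rightarrow> real vec \<Rightarrow> real" where
  "dual_fun s t n d m x F w = Inf (dual_values s t n d m x F w)"


definition colwise_pairs :: "nat \<Rightarrow> nat \<Rightarrow> (nat \<times> nat) list" where
  "colwise_pairs s t = [(i,j). j \<leftarrow> [0..<t], i \<leftarrow> [0..<s]]"

(* For Psi_ij and Phi: one column per basis polynomial of degree bound k. *)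
definition basis_mat :: "nat \<Rightarrow> (nat \<Rightarrow> complex) \<Rightarrow> nat \<Rightarrow> (nat \<Rightarrow> complex poly) \<Rightarrow> complex mat" where
  "basis_mat m x k \<psi> = Matrix.mat m (k + 1) (\<lambda>(l,c). poly (\<psi> c) (x l))"

definition data_stack :: "nat \<Rightarrow> nat \<Rightarrow> nat \<Rightarrow> (nat \<Rightarrow> complex) \<Rightarrow> (complex \<Rightarrow> complex mat) \<Rightarrow> complex mat" where
  "data_stack s t m x F =
     foldr (@\<^sub>r) (map (\<lambda>(i,j). mat_diag m (\<lambda>l. F (x l) $$ (i,j))) (colwise_pairs s t)) (0\<^sub>m 0 m)"

definition Theta_mat ::
  "nat \<Rightarrow> nat \<Rightarrow> (nat \<Rightarrow> nat \<Rightarrow> nat) \<Rightarrow> nat \<Rightarrow> (nat \<Rightarrow> complex) \<Rightarrow> (nat \<Rightarrow> nat \<Rightarrow> nat \<Rightarrow> complex poly) \<Rightarrow> complex mat" where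
  "Theta_mat s t n m x \<psi> =
     diag_block_mat (map (\<lambda>(i,j). basis_mat m x (n i j) (\<psi> i j)) (colwise_pairs s t))"

definition weight_mat :: "nat \<Rightarrow> real vec \<Rightarrow> complex mat" where
  "weight_mat m w = mat_diag m (\<lambda>l. complex_of_real (w $ l))"

definition kronecker :: "complex mat \<Rightarrow> complex mat \<Rightarrow> complex mat" where
  "kronecker A B = Matrix.mat (dim_row A * dim_row B) (dim_col A * dim_col B)
     (\<lambda>(i,j). A $$ (i div dim_row B, j div dim_col B) * B $$ (i mod dim_row B, j mod dim_col B))"

(* Only for diagonal matrices with nonnegative entries, where the entrywise root is the
   positive semidefinite square root. *)
definition diag_sqrt :: "complex mat \<Rightarrow> complex mat" where
  "diag_sqrt A = map_mat csqrt A"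

definition dual_matrix_values ::
  "nat \<Rightarrow> nat \<Rightarrow> (nat \<Rightarrow> nat \<Rightarrow> nat) \<Rightarrow> nat \<Rightarrow> nat \<Rightarrow> (nat \<Rightarrow> complex) \<Rightarrow> (complex \<Rightarrow> complex mat)
   \<Rightarrow> (nat \<Rightarrow> nat \<Rightarrow> nat \<Rightarrow> complex poly) \<Rightarrow> (nat \<Rightarrow> complex poly) \<Rightarrow> real vec \<Rightarrow> real set" where
  "dual_matrix_values s t n d m x F \<psi> \<phi> w =
     (let N = (\<Sum>i<s. \<Sum>j<t. (n i j + 1));
          \<Phi> = basis_mat m x d \<phi>;
          \<Theta> = Theta_mat s t n m x \<psi>;
          FF = data_stack s t m x F;
          W = weight_mat m w;
          WI = kronecker (1\<^sub>m (s * t)) W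
      in {(vec_norm2 (diag_sqrt WI *\<^sub>v (FF *\<^sub>v (\<Phi> *\<^sub>v b) - \<Theta> *\<^sub>v a)))\<^sup>2 | a b.
            a \<in> carrier_vec N \<and> b \<in> carrier_vec (d + 1) \<and>
            vec_norm2 (diag_sqrt W *\<^sub>v (\<Phi> *\<^sub>v b)) = 1})"


definition prob_simplex :: "nat \<Rightarrow> real vec set" where
  "prob_simplex m = {w \<in> carrier_vec m. 0\<^sub>v m \<le> w \<and> (\<Sum>l<m. w $ l) = 1}"

definition nonneg_nonzero :: "nat \<Rightarrow> real vec set" where
  "nonneg_nonzero m = {w \<in> carrier_vec m. 0\<^sub>v m \<le> w \<and> w \<noteq> 0\<^sub>v m}"

end

theory Submission
  imports Defs "HOL-Analysis.Topology_Euclidean_Space"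
begin

text \<open>For fixed weights the residual only sees polynomial values at the nodes of positive weight;
  there the values of polynomials of bounded degree form a closed set (Lagrange interpolation), so
  the minimum defining \<open>d(w)\<close> is attained although the coefficients of minimizing sequences may be
  unbounded. By homogeneity \<open>d(w)\<close> is the least value of a quotient residual/norm, hence invariant
  under scaling of \<open>w\<close>, and testing nearby weights with a minimizer for \<open>w\<close> shows that \<open>d\<close> is
  upper semicontinuous; so the supremum is a maximum over the compact simplex. For weak duality, a
  rational matrix without poles at the nodes has a representation whose denominator vanishes at no
  node, and there the quotient is a weighted average of the errors at the nodes.\<close>

unbundle no vec_syntax
no_notation fps_nth (infixl "$" 75)

subsection \<open>Interpolation and compactness\<close>

definition lagrange_basis :: "(nat \<Rightarrow> 'a::field) \<Rightarrow> nat set \<Rightarrow> nat \<Rightarrow> 'a poly" where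
  "lagrange_basis x K l = (\<Prod>k\<in>K - {l}. Polynomial.smult (inverse (x l - x k)) [:- x k, 1:])"

lemma poly_lagrange_basis:
  assumes "finite K" "inj_on x K" "l \<in> K" "k \<in> K"
  shows "poly (lagrange_basis x K l) (x k) = (if k = l then 1 else 0)"
proof (cases "k = l")
  case True
  have "poly (Polynomial.smult (inverse (x l - x j)) [:- x j, 1:]) (x l) = 1" if "j \<in> K - {l}" for j
  proof -
    have "x l - x j \<noteq> 0"
      using assms that by (auto dest: inj_onD)
    then have "inverse (x l - x j) * (x l - x j) = 1"
      by simp
    then show ?thesis
      by (simp add: algebra_simps)
  qed
  then show ?thesis
    using True by (simp only: lagrange_basis_def poly_prod) (simp add: prod.neutral)
next
  case False
  then show ?thesis
    using assms by (auto simp: lagrange_basis_def poly_prod)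
qed

lemma degree_lagrange_basis:
  assumes "finite K" "l \<in> K"
  shows "degree (lagrange_basis x K l) \<le> card K - 1"
proof -
  have "degree (lagrange_basis x K l) \<le> (\<Sum>k\<in>K - {l}. degree (Polynomial.smult (inverse (x l - x k)) [:- x k, 1:]))"
    unfolding lagrange_basis_def using assms
    by (intro order_trans[OF degree_prod_sum_le]) auto
  also have "\<dots> \<le> (\<Sum>k\<in>K - {l}. 1)"
    by (intro sum_mono) auto
  also have "\<dots> = card K - 1"
    using assms by simp
  finally show ?thesis .
qed

text \<open>Interpolation on a suitable index set \<open>K\<close> is a fixed linear formula that
  reproduces every element of \<open>polys_le N\<close> on \<open>S\<close>, so it can be passed to
  the limit. Only values are assumed to converge; coefficients need not stay bounded.\<close>

lemma polys_le_values_closed: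
  fixes x :: "nat \<Rightarrow> complex"
  assumes S: "finite S" "inj_on x S"
    and p: "\<And>k::nat. p k \<in> polys_le N"
    and lim: "\<And>l. l \<in> S \<Longrightarrow> (\<lambda>k. poly (p k) (x l)) \<longlonglongrightarrow> y l"
  shows "\<exists>P\<in>polys_le N. \<forall>l\<in>S. poly P (x l) = y l"
proof -
  \<comment> \<open>At most \<open>N + 1\<close> indices keep the interpolant within degree
    \<open>N\<close>; the minimum makes \<open>K\<close> all of \<open>S\<close> when
    \<open>S\<close> is small.\<close>
  obtain K where K: "K \<subseteq> S" "card K = min (N + 1) (card S)" "finite K"
    using obtain_subset_with_card_n[of "min (N + 1) (card S)" S] by auto
  have injK: "inj_on x K"
    using S K inj_on_subset by blast
  let ?L = "lagrange_basis x K"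
  have deg: "degree (?L l) \<le> N" if "l \<in> K" for l
    using degree_lagrange_basis[OF K(3) that, of x] K(2) by linarith
  have eval: "poly (\<Sum>l\<in>K. Polynomial.smult (c l) (?L l)) (x k) = c k" if "k \<in> K" for c k
  proof -
    have "poly (\<Sum>l\<in>K. Polynomial.smult (c l) (?L l)) (x k) = (\<Sum>l\<in>K. c l * (if k = l then 1 else 0))"
      using that K by (auto simp: poly_sum poly_lagrange_basis[OF K(3) injK] intro!: sum.cong)
    also have "\<dots> = (\<Sum>l\<in>K. if k = l then c l else 0)"
      by (intro sum.cong) auto
    also have "\<dots> = c k"
      using that K by simp
    finally show ?thesis .
  qed
  have degsum: "degree (\<Sum>l\<in>K. Polynomial.smult (c l) (?L l)) \<le> N" for c
    using K by (intro degree_sum_le) (auto intro: deg order_trans[OF degree_smult_le])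
  \<comment> \<open>If \<open>K\<close> is all of \<open>S\<close>, agreement on \<open>S\<close> is
    immediate even if the interpolant differs from \<open>q\<close>. Otherwise two polynomials of
    degree at most \<open>N\<close> that agree at \<open>N + 1\<close> points coincide.\<close>
  have interp: "poly (\<Sum>l\<in>K. Polynomial.smult (poly q (x l)) (?L l)) (x k) = poly q (x k)"
    if q: "q \<in> polys_le N" and k: "k \<in> S" for q k
  proof (cases "card S \<le> N + 1")
    case True
    then have "K = S"
      using K S by (intro card_subset_eq) auto
    then have "k \<in> K"
      using k by simp
    then show ?thesis
      by (rule eval)
  next
    case False
    then have "card (x ` K) = N + 1"
      using K injK by (simp add: card_image)
    then have "(\<Sum>l\<in>K. Polynomial.smult (poly q (x l)) (?L l)) = q"
      using q degsum[of "\<lambda>l. poly q (x l)"]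
      by (intro poly_eqI_degree[where A = "x ` K"]) (auto simp: polys_le_def eval)
    then show ?thesis
      by simp
  qed
  let ?P = "\<Sum>l\<in>K. Polynomial.smult (y l) (?L l)"
  have "poly ?P (x k) = y k" if "k \<in> S" for k
  \<comment> \<open>At an index outside \<open>K\<close> the value \<open>y k\<close> does not enter
    the interpolant; it is recovered as the limit of the interpolants' values there, which are the
    values of \<open>p j\<close>.\<close>
  proof (rule LIMSEQ_unique)
    have "(\<lambda>j. poly (\<Sum>l\<in>K. Polynomial.smult (poly (p j) (x l)) (?L l)) (x k)) \<longlonglongrightarrow> poly ?P (x k)"
      unfolding poly_sum poly_smult
      using K lim by (intro tendsto_sum tendsto_mult tendsto_const) auto
    then show "(\<lambda>j. poly (p j) (x k)) \<longlonglongrightarrow> poly ?P (x k)"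
      using that p by (simp add: interp)
  qed (use that lim in auto)
  moreover have "?P \<in> polys_le N"
    using degsum by (simp add: polys_le_def)
  ultimately show ?thesis
    by blast
qed

text \<open>Subsequences are extracted one index at a time, and limits already obtained survive
  further extraction. A single subsequence serving all indices lets finitely many nodes and matrix
  entries converge together.\<close>

lemma bounded_family_convergent_subsequence:
  fixes f :: "'i \<Rightarrow> nat \<Rightarrow> 'a::heine_borel"
  assumes "finite I" and "\<And>i. i \<in> I \<Longrightarrow> bounded (range (f i))"
  shows "\<exists>r y. strict_mono (r::nat \<Rightarrow> nat) \<and> (\<forall>i\<in>I. (\<lambda>k. f i (r k)) \<longlonglongrightarrow> y i)"
  using assms
proof (induction I rule: finite_induct)
  case empty
  show ?case
    by (rule exI[of _ id]) (auto simp: strict_mono_def)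
next
  case (insert j I)
  then obtain r y where r: "strict_mono (r::nat \<Rightarrow> nat)" "\<forall>i\<in>I. (\<lambda>k. f i (r k)) \<longlonglongrightarrow> y i"
    by auto
  have "bounded (range (\<lambda>k. f j (r k)))"
    by (rule bounded_subset[OF insert.prems[of j]]) auto
  then obtain z r' where r': "strict_mono (r'::nat \<Rightarrow> nat)" "((\<lambda>k. f j (r k)) \<circ> r') \<longlonglongrightarrow> z"
    using bounded_imp_convergent_subsequence by blast
  have "(\<lambda>k. f i ((r \<circ> r') k)) \<longlonglongrightarrow> (y(j := z)) i" if "i \<in> insert j I" for i
    using LIMSEQ_subseq_LIMSEQ[OF r(2)[rule_format] r'(1), of i] r'(2) that insert.hyps
    by (auto simp: o_def)
  then show ?case
    using strict_mono_o[OF r(1) r'(1)] by blast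
qed

subsection \<open>The dual function\<close>

text \<open>Clearing the denominator makes the quantities inside the modulus linear in the
  coefficients and keeps the expression meaningful where \<open>q\<close> vanishes.\<close>

definition node_residual ::
  "nat \<Rightarrow> nat \<Rightarrow> (complex \<Rightarrow> complex mat) \<Rightarrow> (nat \<Rightarrow> nat \<Rightarrow> complex poly) \<Rightarrow> complex poly \<Rightarrow> complex \<Rightarrow> real" where
  "node_residual s t F p q z = (\<Sum>i<s. \<Sum>j<t. (cmod (F z $$ (i,j) * poly q z - poly (p i j) z))\<^sup>2)"

lemma node_residual_nonneg [simp]: "0 \<le> node_residual s t F p q z"
  by (simp add: node_residual_def sum_nonneg)

lemma node_residual_ge:
  assumes "i < s" "j < t"
  shows "(cmod (F z $$ (i,j) * poly q z - poly (p i j) z))\<^sup>2 \<le> node_residual s t F p q z"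
proof -
  have "(cmod (F z $$ (i,j) * poly q z - poly (p i j) z))\<^sup>2
      \<le> (\<Sum>j<t. (cmod (F z $$ (i,j) * poly q z - poly (p i j) z))\<^sup>2)"
    using assms by (intro member_le_sum[where f = "\<lambda>j. (cmod (F z $$ (i,j) * poly q z - poly (p i j) z))\<^sup>2"]) auto
  also have "\<dots> \<le> node_residual s t F p q z"
    unfolding node_residual_def using assms
    by (intro member_le_sum[where f = "\<lambda>i. \<Sum>j<t. (cmod (F z $$ (i,j) * poly q z - poly (p i j) z))\<^sup>2"])
      (auto intro: sum_nonneg)
  finally show ?thesis .
qed

lemma node_residual_smult:
  "node_residual s t F (\<lambda>i j. Polynomial.smult c (p i j)) (Polynomial.smult c q) z = (cmod c)\<^sup>2 * node_residual s t F p q z"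
proof -
  have "F z $$ (i,j) * (c * poly q z) - c * poly (p i j) z = c * (F z $$ (i,j) * poly q z - poly (p i j) z)"
    for i j by (simp add: algebra_simps)
  then show ?thesis
    by (simp add: node_residual_def sum_distrib_left norm_mult power_mult_distrib)
qed

section \<open>Feasible values and admissible weights\<close>

lemma dual_values_residual:
  "dual_values s t n d m x F w =
     {\<Sum>l<m. w $ l * node_residual s t F p q (x l) | p q.
        (\<forall>i<s. \<forall>j<t. p i j \<in> polys_le (n i j)) \<and> q \<in> polys_le d \<and>
        (\<Sum>l<m. w $ l * (cmod (poly q (x l)))\<^sup>2) = 1}"
  by (simp add: dual_values_def node_residual_def)

lemma zero_vec_le_iff:
  assumes "w \<in> carrier_vec m"
  shows "0\<^sub>v m \<le> w \<longleftrightarrow> (\<forall>l<m. 0 \<le> w $ l)"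
  using assms unfolding Matrix.less_eq_vec_def
  by (metis carrier_vecD index_zero_vec(1) index_zero_vec(2))

lemma nonneg_nonzero_nonneg: "w \<in> nonneg_nonzero m \<Longrightarrow> l < m \<Longrightarrow> 0 \<le> w $ l"
  by (auto simp: nonneg_nonzero_def zero_vec_le_iff)

lemma prob_simplexI:
  assumes "w \<in> carrier_vec m" "\<And>l. l < m \<Longrightarrow> 0 \<le> w $ l" "(\<Sum>l<m. w $ l) = 1"
  shows "w \<in> prob_simplex m"
  using assms by (simp add: prob_simplex_def zero_vec_le_iff)

lemma nonneg_nonzero_sum_pos:
  assumes "w \<in> nonneg_nonzero m"
  shows "0 < (\<Sum>l<m. w $ l)"
proof -
  have "\<exists>l<m. w $ l \<noteq> 0"
  proof (rule ccontr)
    assume "\<not> ?thesis"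
    then have "w = 0\<^sub>v m"
      using assms by (intro eq_vecI) (auto simp: nonneg_nonzero_def)
    then show False
      using assms by (simp add: nonneg_nonzero_def)
  qed
  then obtain l where "l < m" "0 < w $ l"
    using nonneg_nonzero_nonneg[OF assms] by (metis order_le_less)
  then show ?thesis
    using nonneg_nonzero_nonneg[OF assms] by (intro sum_pos2[of _ l]) auto
qed

lemma prob_simplex_nonneg_nonzero: "prob_simplex m \<subseteq> nonneg_nonzero m"
  by (auto simp: prob_simplex_def nonneg_nonzero_def)

lemma dual_values_nonneg:
  assumes "w \<in> nonneg_nonzero m" "v \<in> dual_values s t n d m x F w"
  shows "0 \<le> v"
  using assms nonneg_nonzero_nonneg[OF assms(1)]
  by (auto simp: dual_values_residual intro!: sum_nonneg)

lemma bdd_below_dual_values: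
  assumes "w \<in> nonneg_nonzero m"
  shows "bdd_below (dual_values s t n d m x F w)"
  using dual_values_nonneg[OF assms] by (intro bdd_belowI[of _ 0])

text \<open>The pair is rescaled to meet the normalization, and both sums scale by the same factor.
  Every later upper bound on the dual function comes from testing with a pair in this way.\<close>

lemma dual_fun_le_quotient:
  assumes w: "w \<in> nonneg_nonzero m"
    and p: "\<forall>i<s. \<forall>j<t. p i j \<in> polys_le (n i j)" and q: "q \<in> polys_le d"
    and pos: "0 < (\<Sum>l<m. w $ l * (cmod (poly q (x l)))\<^sup>2)"
  shows "dual_fun s t n d m x F w
      \<le> (\<Sum>l<m. w $ l * node_residual s t F p q (x l)) / (\<Sum>l<m. w $ l * (cmod (poly q (x l)))\<^sup>2)"
proof -
  define D where "D = (\<Sum>l<m. w $ l * (cmod (poly q (x l)))\<^sup>2)"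
  \<comment> \<open>Both sums are quadratic in the pair, so the factor \<open>1 / sqrt D\<close>
    brings the normalizing sum to 1.\<close>
  define c where "c = complex_of_real (1 / sqrt D)"
  have c: "(cmod c)\<^sup>2 = 1 / D"
    using pos by (simp add: c_def D_def norm_divide power_divide)
  have "(\<Sum>l<m. w $ l * (cmod (poly (Polynomial.smult c q) (x l)))\<^sup>2) = (cmod c)\<^sup>2 * D"
    by (simp add: D_def sum_distrib_left norm_mult power_mult_distrib algebra_simps)
  also have "\<dots> = 1"
    using c pos by (simp add: D_def)
  finally have "(\<Sum>l<m. w $ l * node_residual s t F (\<lambda>i j. Polynomial.smult c (p i j)) (Polynomial.smult c q) (x l))
      \<in> dual_values s t n d m x F w"
    using p q unfolding dual_values_residual polys_le_def
    by (intro CollectI exI[of _ "\<lambda>i j. Polynomial.smult c (p i j)"] exI[of _ "Polynomial.smult c q"])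
      (auto intro: order_trans[OF degree_smult_le])
  then have "dual_fun s t n d m x F w
      \<le> (\<Sum>l<m. w $ l * node_residual s t F (\<lambda>i j. Polynomial.smult c (p i j)) (Polynomial.smult c q) (x l))"
    unfolding dual_fun_def by (intro cInf_lower bdd_below_dual_values w)
  also have "\<dots> = (cmod c)\<^sup>2 * (\<Sum>l<m. w $ l * node_residual s t F p q (x l))"
    by (simp add: node_residual_smult sum_distrib_left algebra_simps)
  finally show ?thesis
    by (simp add: c D_def)
qed

lemma dual_values_nonempty:
  assumes w: "w \<in> nonneg_nonzero m"
  shows "dual_values s t n d m x F w \<noteq> {}"
proof -
  \<comment> \<open>A constant denominator, normalized by the total weight, is feasible together
    with zero numerators.\<close>
  define c where "c = 1 / sqrt (\<Sum>l<m. w $ l)"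
  have "(\<Sum>l<m. w $ l * (cmod (poly [:complex_of_real c:] (x l)))\<^sup>2) = (\<Sum>l<m. w $ l) * c\<^sup>2"
    by (simp add: sum_distrib_right)
  also have "\<dots> = 1"
    using nonneg_nonzero_sum_pos[OF w] by (simp add: c_def power_divide)
  finally show ?thesis
    unfolding dual_values_residual polys_le_def
    by (auto intro!: exI[of _ "\<lambda>i j. 0"] exI[of _ "[:complex_of_real c:]"])
qed

section \<open>Attainment of the minimum\<close>

text \<open>The direct method is applied to node values: along a minimizing sequence the values at
  positively weighted nodes are bounded, and by \<open>polys_le_values_closed\<close> their limits
  are again values of admissible polynomials.\<close>

lemma dual_fun_attained:
  assumes x: "inj_on x {..<m}" and w: "w \<in> nonneg_nonzero m"
  shows "attained_min (dual_values s t n d m x F w) (dual_fun s t n d m x F w)"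
proof -
  define V where "V = dual_values s t n d m x F w"
  define v where "v = dual_fun s t n d m x F w"
  have v_le: "v \<le> u" if "u \<in> V" for u
    using that bdd_below_dual_values[OF w] by (auto simp: V_def v_def dual_fun_def intro: cInf_lower)
  have approx: "\<exists>u\<in>V. u < v + inverse (real (Suc k))" for k
    using dual_values_nonempty[OF w] bdd_below_dual_values[OF w]
    by (subst cInf_less_iff[symmetric]) (auto simp: V_def v_def dual_fun_def)
  \<comment> \<open>Bundling feasibility with near-optimality lets \<open>p\<close> and then
    \<open>q\<close> be chosen for every \<open>k\<close>, which gives a minimizing
    sequence.\<close>
  define good where "good k p q \<longleftrightarrow> (\<forall>i<s. \<forall>j<t. p i j \<in> polys_le (n i j)) \<and> q \<in> polys_le d \<and>
        (\<Sum>l<m. w $ l * (cmod (poly q (x l)))\<^sup>2) = 1 \<and>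
        (\<Sum>l<m. w $ l * node_residual s t F p q (x l)) < v + inverse (real (Suc k))" for k p q
  have "\<forall>k. \<exists>p q. good k p q"
    using approx unfolding V_def dual_values_residual good_def by blast
  then obtain p where "\<forall>k. \<exists>q. good k (p k) q"
    using choice[of "\<lambda>k p. \<exists>q. good k p q"] by blast
  then obtain q where good: "\<And>k. good k (p k) (q k)"
    using choice[of "\<lambda>k q. good k (p k) q"] by blast
  then have p: "\<And>k i j. i < s \<Longrightarrow> j < t \<Longrightarrow> p k i j \<in> polys_le (n i j)"
    and q: "\<And>k. q k \<in> polys_le d"
    and norm1: "\<And>k. (\<Sum>l<m. w $ l * (cmod (poly (q k) (x l)))\<^sup>2) = 1"
    and near: "\<And>k. (\<Sum>l<m. w $ l * node_residual s t F (p k) (q k) (x l)) < v + inverse (real (Suc k))"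
    unfolding good_def by blast+
  \<comment> \<open>Nodes of weight zero impose no bound on the sequence and contribute nothing to
    either sum.\<close>
  define S where "S = {l. l < m \<and> 0 < w $ l}"
  have S: "finite S" "inj_on x S" and Sm: "\<And>l. l \<in> S \<Longrightarrow> l < m" and Spos: "\<And>l. l \<in> S \<Longrightarrow> 0 < w $ l"
    using inj_on_subset[OF x, of S] by (auto simp: S_def)
  have zero: "w $ l = 0" if "l < m" "l \<notin> S" for l
    using that nonneg_nonzero_nonneg[OF w that(1)] by (auto simp: S_def)

  \<comment> \<open>A single term of the normalizing sum is at most 1.\<close>
  have qbd: "cmod (poly (q k) (x l)) \<le> sqrt (1 / w $ l)" if l: "l \<in> S" for k l
  proof -
    have "w $ l * (cmod (poly (q k) (x l)))\<^sup>2 \<le> (\<Sum>l<m. w $ l * (cmod (poly (q k) (x l)))\<^sup>2)"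
      using Sm[OF l] nonneg_nonzero_nonneg[OF w]
      by (intro member_le_sum[where f = "\<lambda>l. w $ l * (cmod (poly (q k) (x l)))\<^sup>2"]) auto
    then have "(cmod (poly (q k) (x l)))\<^sup>2 \<le> 1 / w $ l"
      using Spos[OF l] norm1[of k] by (simp add: field_simps)
    then show ?thesis
      by (rule real_le_rsqrt)
  qed
  \<comment> \<open>Near-optimality bounds the weighted residual by \<open>v + 1\<close>, since
    \<open>inverse (real (Suc k))\<close> is at most 1; the numerator is the data times
    \<open>q k\<close> minus the residual entry \<open>?e\<close>.\<close>
  have pbd: "cmod (poly (p k i j) (x l)) \<le> sqrt ((v + 1) / w $ l) + cmod (F (x l) $$ (i,j)) * sqrt (1 / w $ l)"
    if l: "l \<in> S" and ij: "i < s" "j < t" for k l i j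
  proof -
    let ?e = "F (x l) $$ (i,j) * poly (q k) (x l) - poly (p k i j) (x l)"
    have "w $ l * (cmod ?e)\<^sup>2 \<le> w $ l * node_residual s t F (p k) (q k) (x l)"
      using Spos[OF l] node_residual_ge[OF ij] by simp
    also have "\<dots> \<le> (\<Sum>l<m. w $ l * node_residual s t F (p k) (q k) (x l))"
      using Sm[OF l] nonneg_nonzero_nonneg[OF w]
      by (intro member_le_sum[where f = "\<lambda>l. w $ l * node_residual s t F (p k) (q k) (x l)"]) auto
    also have "\<dots> \<le> v + 1"
      using near[of k] by (rule order.trans[OF less_imp_le]) (simp add: field_simps)
    finally have "(cmod ?e)\<^sup>2 \<le> (v + 1) / w $ l"
      using Spos[OF l] by (simp add: field_simps)
    then have e: "cmod ?e \<le> sqrt ((v + 1) / w $ l)"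
      by (rule real_le_rsqrt)
    have "cmod (poly (p k i j) (x l)) = cmod (F (x l) $$ (i,j) * poly (q k) (x l) - ?e)"
      by simp
    also have "\<dots> \<le> cmod (F (x l) $$ (i,j)) * cmod (poly (q k) (x l)) + cmod ?e"
      by (metis norm_mult norm_triangle_ineq4)
    also have "\<dots> \<le> cmod (F (x l) $$ (i,j)) * sqrt (1 / w $ l) + sqrt ((v + 1) / w $ l)"
      using e qbd[OF l] by (intro add_mono mult_left_mono) auto
    finally show ?thesis
      by simp
  qed

  have "\<exists>r y. strict_mono (r::nat \<Rightarrow> nat) \<and> (\<forall>l\<in>S. (\<lambda>k. poly (q (r k)) (x l)) \<longlonglongrightarrow> y l)"
    using qbd by (intro bounded_family_convergent_subsequence[where f = "\<lambda>l k. poly (q k) (x l)"] S)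
      (auto intro!: boundedI)
  then obtain r y where r: "strict_mono (r::nat \<Rightarrow> nat)"
      and y: "\<And>l. l \<in> S \<Longrightarrow> (\<lambda>k. poly (q (r k)) (x l)) \<longlonglongrightarrow> y l"
    by blast
  \<comment> \<open>The numerators are refined along \<open>r\<close>, with one coordinate per
    triple of entry indices and node; the limits for \<open>q\<close> then persist along
    \<open>r'\<close>.\<close>
  let ?I = "{..<s} \<times> {..<t} \<times> S"
  have "\<exists>r' y'. strict_mono (r'::nat \<Rightarrow> nat) \<and>
      (\<forall>a\<in>?I. (\<lambda>k. case a of (i,j,l) \<Rightarrow> poly (p (r (r' k)) i j) (x l)) \<longlonglongrightarrow> y' a)"
    by (intro bounded_family_convergent_subsequence[where f = "\<lambda>a k. case a of (i,j,l) \<Rightarrow> poly (p (r k) i j) (x l)"])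
      (use S pbd in \<open>auto intro!: boundedI\<close>)
  then obtain r' y' where r': "strict_mono (r'::nat \<Rightarrow> nat)"
      and y': "\<And>i j l. i < s \<Longrightarrow> j < t \<Longrightarrow> l \<in> S \<Longrightarrow>
                 (\<lambda>k. poly (p (r (r' k)) i j) (x l)) \<longlonglongrightarrow> y' (i,j,l)"
    by fastforce
  have y: "(\<lambda>k. poly (q (r (r' k))) (x l)) \<longlonglongrightarrow> y l" if "l \<in> S" for l
    using LIMSEQ_subseq_LIMSEQ[OF y[OF that] r'] by (simp add: o_def)

  obtain Q where Q: "Q \<in> polys_le d" "\<And>l. l \<in> S \<Longrightarrow> poly Q (x l) = y l"
    using polys_le_values_closed[OF S, of "\<lambda>k. q (r (r' k))" d y] q y by auto
  have "\<exists>P. P \<in> polys_le (n i j) \<and> (\<forall>l\<in>S. poly P (x l) = y' (i,j,l))" if "i < s" "j < t" for i j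
    using polys_le_values_closed[OF S, of "\<lambda>k. p (r (r' k)) i j" "n i j" "\<lambda>l. y' (i,j,l)"] p y' that
    by auto
  then obtain P where P: "\<And>i j. i < s \<Longrightarrow> j < t \<Longrightarrow> P i j \<in> polys_le (n i j)"
      "\<And>i j l. i < s \<Longrightarrow> j < t \<Longrightarrow> l \<in> S \<Longrightarrow> poly (P i j) (x l) = y' (i,j,l)"
    by metis

  \<comment> \<open>Off \<open>S\<close> each term is zero for the sequence and for its limit alike,
    so convergence at the nodes of \<open>S\<close> suffices.\<close>
  have limD: "(\<lambda>k. \<Sum>l<m. w $ l * (cmod (poly (q (r (r' k))) (x l)))\<^sup>2)
      \<longlonglongrightarrow> (\<Sum>l<m. w $ l * (cmod (poly Q (x l)))\<^sup>2)"
  proof (intro tendsto_sum)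
    fix l assume "l \<in> {..<m}"
    then show "(\<lambda>k. w $ l * (cmod (poly (q (r (r' k))) (x l)))\<^sup>2) \<longlonglongrightarrow> w $ l * (cmod (poly Q (x l)))\<^sup>2"
      using zero[of l] y[of l] Q(2)[of l] by (cases "l \<in> S") (auto intro!: tendsto_intros)
  qed
  have limN: "(\<lambda>k. \<Sum>l<m. w $ l * node_residual s t F (p (r (r' k))) (q (r (r' k))) (x l))
      \<longlonglongrightarrow> (\<Sum>l<m. w $ l * node_residual s t F P Q (x l))"
  proof (intro tendsto_sum)
    fix l assume l: "l \<in> {..<m}"
    show "(\<lambda>k. w $ l * node_residual s t F (p (r (r' k))) (q (r (r' k))) (x l))
        \<longlonglongrightarrow> w $ l * node_residual s t F P Q (x l)"
    proof (cases "l \<in> S")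
      case True
      then show ?thesis
        using y y' P(2) Q(2) unfolding node_residual_def
        by (intro tendsto_intros) auto
    qed (use l zero in auto)
  qed
  \<comment> \<open>The normalizing sum is constantly 1 along the sequence, so the limit pair is
    feasible.\<close>
  have D1: "(\<Sum>l<m. w $ l * (cmod (poly Q (x l)))\<^sup>2) = 1"
    using limD norm1 by (simp add: LIMSEQ_const_iff)
  have "(\<lambda>k. v + inverse (real (Suc (r (r' k))))) \<longlonglongrightarrow> v + 0"
    using LIMSEQ_subseq_LIMSEQ[OF LIMSEQ_inverse_real_of_nat strict_mono_o[OF r r']]
    by (intro tendsto_add tendsto_const) (simp add: o_def)
  then have "(\<Sum>l<m. w $ l * node_residual s t F P Q (x l)) \<le> v + 0"
    using near by (intro LIMSEQ_le[OF limN]) (auto intro: less_imp_le)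
  moreover have "(\<Sum>l<m. w $ l * node_residual s t F P Q (x l)) \<in> V"
    unfolding V_def dual_values_residual using P(1) Q(1) D1 by blast
  \<comment> \<open>Feasibility of the limit pair gives the reverse inequality, so its value is
    exactly \<open>v\<close>.\<close>
  ultimately have "v \<in> V"
    using v_le by force
  then show ?thesis
    using v_le by (auto simp: attained_min_def V_def v_def)
qed

lemma dual_fun_minimizer:
  assumes "inj_on x {..<m}" "w \<in> nonneg_nonzero m"
  obtains p q where "\<forall>i<s. \<forall>j<t. p i j \<in> polys_le (n i j)" "q \<in> polys_le d"
    "(\<Sum>l<m. w $ l * (cmod (poly q (x l)))\<^sup>2) = 1"
    "dual_fun s t n d m x F w = (\<Sum>l<m. w $ l * node_residual s t F p q (x l))"
  using dual_fun_attained[OF assms, of s t n d F]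
  unfolding attained_min_def dual_values_residual by blast

section \<open>Maximization over the simplex\<close>

text \<open>A minimizer for \<open>w\<close> is kept fixed as test pair for the nearby weights; the
  resulting quotient is continuous at \<open>w\<close>, where its denominator is 1.\<close>

lemma dual_fun_upper_semicontinuous:
  assumes x: "inj_on x {..<m}" and w: "w \<in> nonneg_nonzero m"
    and W: "\<And>k::nat. W k \<in> nonneg_nonzero m"
    and lim: "\<And>l. l < m \<Longrightarrow> (\<lambda>k. W k $ l) \<longlonglongrightarrow> w $ l"
    and M: "(\<lambda>k. dual_fun s t n d m x F (W k)) \<longlonglongrightarrow> M"
  shows "M \<le> dual_fun s t n d m x F w"
proof -
  obtain p q where pq: "\<forall>i<s. \<forall>j<t. p i j \<in> polys_le (n i j)" "q \<in> polys_le d"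
    and D: "(\<Sum>l<m. w $ l * (cmod (poly q (x l)))\<^sup>2) = 1"
    and N: "dual_fun s t n d m x F w = (\<Sum>l<m. w $ l * node_residual s t F p q (x l))"
    using dual_fun_minimizer[OF x w] .
  have limD: "(\<lambda>k. \<Sum>l<m. W k $ l * (cmod (poly q (x l)))\<^sup>2) \<longlonglongrightarrow> 1"
    unfolding D[symmetric] using lim by (intro tendsto_intros) auto
  have limN: "(\<lambda>k. \<Sum>l<m. W k $ l * node_residual s t F p q (x l)) \<longlonglongrightarrow> dual_fun s t n d m x F w"
    unfolding N using lim by (intro tendsto_intros) auto
  \<comment> \<open>Feasibility at \<open>w\<close> ensures a positive denominator only for weights
    close to \<open>w\<close>, so the quotient bound holds from some index on.\<close>
  have "eventually (\<lambda>k. 0 < (\<Sum>l<m. W k $ l * (cmod (poly q (x l)))\<^sup>2)) sequentially"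
    using limD by (rule order_tendstoD) simp
  then have "eventually (\<lambda>k. dual_fun s t n d m x F (W k)
      \<le> (\<Sum>l<m. W k $ l * node_residual s t F p q (x l)) / (\<Sum>l<m. W k $ l * (cmod (poly q (x l)))\<^sup>2)) sequentially"
    by eventually_elim (rule dual_fun_le_quotient[OF W pq])
  then show ?thesis
    using tendsto_le[OF _ tendsto_divide[OF limN limD] M] by simp
qed

text \<open>A maximizing sequence in the compact simplex has a convergent subsequence, and upper
  semicontinuity carries the supremum to its limit.\<close>

lemma dual_fun_attains_max:
  assumes x: "inj_on x {..<m}" and m: "0 < m"
  obtains w where "w \<in> prob_simplex m"
    "\<And>u. u \<in> prob_simplex m \<Longrightarrow> dual_fun s t n d m x F u \<le> dual_fun s t n d m x F w"
proof -
  let ?d = "dual_fun s t n d m x F"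
  have le1: "u $ l \<le> 1" and ge0: "0 \<le> u $ l" if "u \<in> prob_simplex m" "l < m" for u l
  proof -
    have nonneg: "0 \<le> u $ l" if "l < m" for l
      using that nonneg_nonzero_nonneg \<open>u \<in> prob_simplex m\<close> prob_simplex_nonneg_nonzero by blast
    then show "0 \<le> u $ l"
      using that by blast
    have "u $ l \<le> (\<Sum>l<m. u $ l)"
      using that nonneg
      by (intro member_le_sum[where f = "\<lambda>l. u $ l"]) auto
    then show "u $ l \<le> 1"
      using that by (simp add: prob_simplex_def)
  qed
  \<comment> \<open>Testing with zero numerators and denominator 1 gives a bound uniform in
    \<open>u\<close>, because each weight is at most 1.\<close>
  have "?d u \<le> (\<Sum>l<m. node_residual s t F (\<lambda>i j. 0) 1 (x l))" if u: "u \<in> prob_simplex m" for u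
  proof -
    have su: "(\<Sum>l<m. u $ l * (cmod (poly 1 (x l)))\<^sup>2) = 1"
      using u by (simp add: prob_simplex_def)
    have "?d u \<le> (\<Sum>l<m. u $ l * node_residual s t F (\<lambda>i j. 0) 1 (x l))
        / (\<Sum>l<m. u $ l * (cmod (poly 1 (x l)))\<^sup>2)"
      using u prob_simplex_nonneg_nonzero su
      by (intro dual_fun_le_quotient) (auto simp: polys_le_def)
    also have "\<dots> \<le> (\<Sum>l<m. node_residual s t F (\<lambda>i j. 0) 1 (x l))"
      unfolding su using u le1 ge0 by (auto intro!: sum_mono mult_left_le_one_le)
    finally show ?thesis .
  qed
  then have bdd: "bdd_above (?d ` prob_simplex m)"
    by (intro bdd_aboveI2)
  \<comment> \<open>Uniform weights show that the simplex is nonempty; this is where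
    \<open>m\<close> must be positive.\<close>
  have "Matrix.vec m (\<lambda>l. 1 / real m) \<in> prob_simplex m"
    using m by (intro prob_simplexI) auto
  then have ne: "?d ` prob_simplex m \<noteq> {}"
    by blast
  define M where "M = Sup (?d ` prob_simplex m)"
  have le_M: "?d u \<le> M" if "u \<in> prob_simplex m" for u
    unfolding M_def using that bdd by (intro cSup_upper) auto
  have "\<exists>u\<in>prob_simplex m. M - inverse (real (Suc k)) < ?d u" for k
    using ne bdd less_cSup_iff[of "?d ` prob_simplex m" "M - inverse (real (Suc k))"]
    by (auto simp: M_def)
  then obtain W where W: "\<And>k::nat. W k \<in> prob_simplex m"
      and near: "\<And>k. M - inverse (real (Suc k)) < ?d (W k)"
    by metis
  have "(\<lambda>k. ?d (W k)) \<longlonglongrightarrow> M"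
  proof (rule tendsto_sandwich)
    show "(\<lambda>k. M - inverse (real (Suc k))) \<longlonglongrightarrow> M"
      using tendsto_diff[OF tendsto_const LIMSEQ_inverse_real_of_nat, of M] by simp
    show "\<forall>\<^sub>F k in sequentially. M - inverse (real (Suc k)) \<le> ?d (W k)"
      using near by (intro always_eventually allI less_imp_le)
  qed (use W le_M in auto)
  moreover have "\<exists>r y. strict_mono (r::nat \<Rightarrow> nat) \<and> (\<forall>l\<in>{..<m}. (\<lambda>k. W (r k) $ l) \<longlonglongrightarrow> y l)"
    using le1[OF W] ge0[OF W]
    by (intro bounded_family_convergent_subsequence[where f = "\<lambda>l k. W k $ l"])
      (auto intro!: boundedI[where B = 1])
  then obtain r y where r: "strict_mono (r::nat \<Rightarrow> nat)"
      and y: "\<And>l. l < m \<Longrightarrow> (\<lambda>k. W (r k) $ l) \<longlonglongrightarrow> y l"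
    by blast
  define w where "w = Matrix.vec m y"
  have lim: "(\<lambda>k. W (r k) $ l) \<longlonglongrightarrow> w $ l" if "l < m" for l
    using y[OF that] that by (simp add: w_def)
  \<comment> \<open>Both the unit sum and nonnegativity pass to coordinatewise limits.\<close>
  have "(\<lambda>k. \<Sum>l<m. W (r k) $ l) \<longlonglongrightarrow> (\<Sum>l<m. w $ l)"
    using lim by (intro tendsto_sum) auto
  moreover have "(\<Sum>l<m. W k $ l) = 1" for k
    using W[of k] by (simp add: prob_simplex_def)
  ultimately have "(\<Sum>l<m. w $ l) = 1"
    by (simp add: LIMSEQ_const_iff)
  moreover have "0 \<le> w $ l" if "l < m" for l
    using lim[OF that] ge0[OF W that] by (intro LIMSEQ_le_const) auto
  ultimately have wS: "w \<in> prob_simplex m"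
    by (intro prob_simplexI) (auto simp: w_def)
  have "M \<le> ?d w"
  proof (rule dual_fun_upper_semicontinuous[OF x])
    show "(\<lambda>k. ?d (W (r k))) \<longlonglongrightarrow> M"
      using LIMSEQ_subseq_LIMSEQ[OF \<open>(\<lambda>k. ?d (W k)) \<longlonglongrightarrow> M\<close> r] by (simp add: o_def)
  qed (use wS W prob_simplex_nonneg_nonzero lim in auto)
  then show thesis
    using that[OF wS] le_M by (meson order_trans)
qed

text \<open>With \<open>w\<close> written as its total weight times \<open>u\<close>, a minimizer
  for \<open>u\<close> tests \<open>w\<close>, and the total cancels from the quotient. This one
  inequality is enough to reduce the supremum to the simplex.\<close>

lemma dual_fun_le_normalized:
  assumes x: "inj_on x {..<m}" and w: "w \<in> nonneg_nonzero m"
  obtains u where "u \<in> prob_simplex m" "dual_fun s t n d m x F w \<le> dual_fun s t n d m x F u"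
proof -
  define c where "c = (\<Sum>l<m. w $ l)"
  define u where "u = Matrix.vec m (\<lambda>l. w $ l / c)"
  have c: "0 < c"
    using nonneg_nonzero_sum_pos[OF w] by (simp add: c_def)
  have wu: "w $ l = c * u $ l" if "l < m" for l
    using that c by (simp add: u_def)
  have "(\<Sum>l<m. u $ l) = (\<Sum>l<m. w $ l) / c"
    by (simp add: u_def sum_divide_distrib)
  then have u: "u \<in> prob_simplex m"
    using c nonneg_nonzero_nonneg[OF w] by (intro prob_simplexI) (auto simp: u_def c_def)
  then have "u \<in> nonneg_nonzero m"
    using prob_simplex_nonneg_nonzero by blast
  then obtain p q where pq: "\<forall>i<s. \<forall>j<t. p i j \<in> polys_le (n i j)" "q \<in> polys_le d"
    and D: "(\<Sum>l<m. u $ l * (cmod (poly q (x l)))\<^sup>2) = 1"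
    and N: "dual_fun s t n d m x F u = (\<Sum>l<m. u $ l * node_residual s t F p q (x l))"
    by (rule dual_fun_minimizer[OF x])
  have Dw: "(\<Sum>l<m. w $ l * (cmod (poly q (x l)))\<^sup>2) = c * (\<Sum>l<m. u $ l * (cmod (poly q (x l)))\<^sup>2)"
    by (simp add: wu sum_distrib_left mult.assoc)
  have Nw: "(\<Sum>l<m. w $ l * node_residual s t F p q (x l)) = c * dual_fun s t n d m x F u"
    by (simp add: N wu sum_distrib_left mult.assoc)
  have "dual_fun s t n d m x F w \<le> dual_fun s t n d m x F u"
    using dual_fun_le_quotient[OF w pq, of x F] c by (simp add: Dw D Nw)
  then show thesis
    using that u by blast
qed

subsection \<open>Weak duality\<close>

text \<open>Two representations of the same fraction are cross-multiplied, and
  \<open>to_fract\<close> is injective. Being an identity of polynomials, it can be evaluated even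
  at zeros of \<open>q\<close>.\<close>

lemma quot_of_fract_cross:
  assumes "q \<noteq> 0"
  shows "fst (quot_of_fract (to_fract p / to_fract q)) * q = p * snd (quot_of_fract (to_fract p / to_fract q))"
proof -
  let ?r = "to_fract p / to_fract q"
  let ?a = "fst (quot_of_fract ?r)" and ?b = "snd (quot_of_fract ?r)"
  have "to_fract ?a / to_fract ?b = ?r"
    by (metis Fract_conv_to_fract Fract_quot_of_fract)
  then have "to_fract (?a * q) = to_fract (p * ?b)"
    using assms by (simp only: to_fract_mult) (simp add: field_simps)
  then show ?thesis
    by (simp only: to_fract_eq_iff)
qed

text \<open>At a non-pole where \<open>q\<close> vanishes this forces \<open>p\<close> to vanish
  too, which is what makes a common cancellation possible.\<close>

lemma rat_value_mult:
  assumes "q \<noteq> 0" "\<not> rat_pole (to_fract p / to_fract q) z"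
  shows "rat_value (to_fract p / to_fract q) z * poly q z = poly p z"
  using arg_cong[OF quot_of_fract_cross[OF assms(1), of p], of "\<lambda>p. poly p z"] assms(2)
  by (simp add: rat_value_def rat_pole_def field_simps)

text \<open>A zero of \<open>q\<close> at a node where no entry has a pole is shared by all numerators, so
  \<open>[:- z, 1:]\<close> can be cancelled from the whole representation without raising any degree.\<close>

lemma common_denominator_nonvanishing:
  fixes q :: "complex poly" and p :: "nat \<Rightarrow> nat \<Rightarrow> complex poly"
  assumes "q \<noteq> 0" and "\<forall>i<s. \<forall>j<t. \<forall>z\<in>Z. \<not> rat_pole (to_fract (p i j) / to_fract q) z"
  shows "\<exists>p' q'. q' \<noteq> 0 \<and> degree q' \<le> degree q \<and> (\<forall>z\<in>Z. poly q' z \<noteq> 0) \<and>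
    (\<forall>i<s. \<forall>j<t. degree (p' i j) \<le> degree (p i j) \<and> to_fract (p' i j) / to_fract q' = to_fract (p i j) / to_fract q)"
  using assms
proof (induction "degree q" arbitrary: p q rule: less_induct)
  case less
  show ?case
  proof (cases "\<forall>z\<in>Z. poly q z \<noteq> 0")
    case True
    then show ?thesis
      using less.prems(1) by blast
  next
    case False
    then obtain z where z: "z \<in> Z" "poly q z = 0"
      by blast
    define h where "h = [:- z, 1:]"
    define q1 where "q1 = q div h"
    define p1 where "p1 i j = p i j div h" for i j
    have h: "h \<noteq> 0" "degree h = 1"
      by (simp_all add: h_def)
    have q1: "q = h * q1"
      using z(2) unfolding q1_def h_def poly_eq_0_iff_dvd by (rule dvd_mult_div_cancel[symmetric])
    have p1: "p i j = h * p1 i j" if "i < s" "j < t" for i j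
    proof -
      have "poly (p i j) z = 0"
        using rat_value_mult[OF less.prems(1), of "p i j" z] less.prems(2)[rule_format, OF that z(1)] z(2) by simp
      then show ?thesis
        unfolding p1_def h_def poly_eq_0_iff_dvd by (rule dvd_mult_div_cancel[symmetric])
    qed
    have "q1 \<noteq> 0"
      using q1 less.prems(1) by auto
    \<comment> \<open>The degree of the denominator drops by exactly one, which drives the
      induction.\<close>
    then have deg: "degree q = Suc (degree q1)"
      using h by (simp add: q1 degree_mult_eq)
    have eq: "to_fract (p1 i j) / to_fract q1 = to_fract (p i j) / to_fract q" if "i < s" "j < t" for i j
      using h by (simp add: q1 p1[OF that] to_fract_mult)
    \<comment> \<open>A zero numerator is treated separately, as degrees add only for nonzero
      factors.\<close>
    have degp: "degree (p1 i j) \<le> degree (p i j)" if "i < s" "j < t" for i j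
      using h by (cases "p1 i j = 0") (simp_all add: p1[OF that] degree_mult_eq)
    have "\<exists>p' q'. q' \<noteq> 0 \<and> degree q' \<le> degree q1 \<and> (\<forall>z\<in>Z. poly q' z \<noteq> 0) \<and>
      (\<forall>i<s. \<forall>j<t. degree (p' i j) \<le> degree (p1 i j) \<and> to_fract (p' i j) / to_fract q' = to_fract (p1 i j) / to_fract q1)"
      using less.prems(2) deg eq by (intro less.hyps) (use \<open>q1 \<noteq> 0\<close> in auto)
    then obtain p' q' where "q' \<noteq> 0" "degree q' \<le> degree q1" "\<forall>z\<in>Z. poly q' z \<noteq> 0"
      "\<forall>i<s. \<forall>j<t. degree (p' i j) \<le> degree (p1 i j) \<and> to_fract (p' i j) / to_fract q' = to_fract (p1 i j) / to_fract q1"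
      by blast
    then show ?thesis
      using eq deg degp by (intro exI[of _ p'] exI[of _ q']) (use order_trans[OF _ degp] in auto)
  qed
qed

lemma frobenius_norm_power2:
  assumes "A \<in> carrier_mat s t"
  shows "(frobenius_norm A)\<^sup>2 = (\<Sum>i<s. \<Sum>j<t. (cmod (A $$ (i,j)))\<^sup>2)"
proof -
  have "(frobenius_norm A)\<^sup>2 = (\<Sum>(i,j)\<in>{..<s} \<times> {..<t}. (cmod (A $$ (i,j)))\<^sup>2)"
    using assms unfolding frobenius_norm_def L2_set_def
    by (subst real_sqrt_pow2) (auto intro!: sum_nonneg sum.cong)
  then show ?thesis
    by (simp add: sum.cartesian_product)
qed

text \<open>An infinite error makes the bound trivial. Otherwise the quotient is an average of the
  errors, weighted by \<open>w $ l\<close> times the squared modulus of \<open>q\<close> at the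
  node, and cannot exceed their maximum.\<close>

lemma dual_fun_le_max_error:
  assumes w: "w \<in> nonneg_nonzero m"
    and F: "\<forall>l<m. F (x l) \<in> carrier_mat s t"
    and R: "R \<in> rat_matrices s t n d"
  shows "ereal (dual_fun s t n d m x F w) \<le> Max ((\<lambda>l. sq_error F R (x l)) ` {..<m})"
proof (cases "\<exists>l<m. sq_error F R (x l) = \<infinity>")
  case True
  then have "\<infinity> \<le> Max ((\<lambda>l. sq_error F R (x l)) ` {..<m})"
    by (metis (no_types, lifting) Max_ge finite_imageI finite_lessThan image_eqI lessThan_iff)
  then show ?thesis
    by simp
next
  case False
  obtain p0 q0 where R0: "R = Matrix.mat s t (\<lambda>(i,j). to_fract (p0 i j) / to_fract q0)"
    and p0: "\<forall>i<s. \<forall>j<t. p0 i j \<in> polys_le (n i j)" and q0: "q0 \<in> polys_le d" "q0 \<noteq> 0"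
    using R unfolding rat_matrices_def by blast
  have nopole: "\<not> rat_pole (to_fract (p0 i j) / to_fract q0) (x l)" if "i < s" "j < t" "l < m" for i j l
  proof
    assume "rat_pole (to_fract (p0 i j) / to_fract q0) (x l)"
    then have "sq_error F R (x l) = \<infinity>"
      using that by (auto simp: sq_error_def R0)
    then show False
      using False that by blast
  qed
  have "\<forall>i<s. \<forall>j<t. \<forall>z\<in>x ` {..<m}. \<not> rat_pole (to_fract (p0 i j) / to_fract q0) z"
    using nopole by auto
  \<comment> \<open>The original \<open>q0\<close> may vanish at every node of positive weight,
    which would make the quotient useless; the new pair has the same quotients and no larger
    degrees.\<close>
  from common_denominator_nonvanishing[OF q0(2) this]
  obtain p q where q: "q \<noteq> 0" "degree q \<le> degree q0" "\<forall>z\<in>x ` {..<m}. poly q z \<noteq> 0"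
    and p: "\<forall>i<s. \<forall>j<t. degree (p i j) \<le> degree (p0 i j) \<and>
              to_fract (p i j) / to_fract q = to_fract (p0 i j) / to_fract q0"
    by (elim exE conjE) (rule that)
  have pq: "\<forall>i<s. \<forall>j<t. p i j \<in> polys_le (n i j)" "q \<in> polys_le d"
    using p p0 q q0 by (fastforce simp: polys_le_def intro: order_trans)+
  define E where "E l = (\<Sum>i<s. \<Sum>j<t. (cmod (F (x l) $$ (i,j) - rat_value (R $$ (i,j)) (x l)))\<^sup>2)" for l
  have err: "sq_error F R (x l) = ereal (E l)" if l: "l < m" for l
  proof -
    have "F (x l) - map_mat (\<lambda>r. rat_value r (x l)) R \<in> carrier_mat s t"
      using F l by (auto simp: R0)
    then have "(frobenius_norm (F (x l) - map_mat (\<lambda>r. rat_value r (x l)) R))\<^sup>2 = E l"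
      using F l by (simp add: frobenius_norm_power2 E_def R0)
    moreover have "sq_error F R (x l) \<noteq> \<infinity>"
      using False l by blast
    ultimately show ?thesis
      by (auto simp: sq_error_def split: if_splits)
  qed
  have res: "node_residual s t F p q (x l) = (cmod (poly q (x l)))\<^sup>2 * E l" if l: "l < m" for l
  proof -
    have "cmod (F (x l) $$ (i,j) * poly q (x l) - poly (p i j) (x l))
        = cmod (poly q (x l)) * cmod (F (x l) $$ (i,j) - rat_value (R $$ (i,j)) (x l))"
      if ij: "i < s" "j < t" for i j
    proof -
      have r: "R $$ (i,j) = to_fract (p i j) / to_fract q"
        using p ij by (simp add: R0)
      have "\<not> rat_pole (to_fract (p i j) / to_fract q) (x l)"
        using nopole[OF ij l] p ij by simp
      then have "rat_value (R $$ (i,j)) (x l) * poly q (x l) = poly (p i j) (x l)"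
        unfolding r by (rule rat_value_mult[OF q(1)])
      then have "F (x l) $$ (i,j) * poly q (x l) - poly (p i j) (x l)
          = poly q (x l) * (F (x l) $$ (i,j) - rat_value (R $$ (i,j)) (x l))"
        by (simp add: algebra_simps)
      then show ?thesis
        by (simp add: norm_mult)
    qed
    then show ?thesis
      by (simp add: node_residual_def E_def sum_distrib_left power_mult_distrib)
  qed
  define D where "D = (\<Sum>l<m. w $ l * (cmod (poly q (x l)))\<^sup>2)"
  have wnn: "0 \<le> w $ l" if "l < m" for l
    using nonneg_nonzero_nonneg[OF w that] .
  obtain k where k: "k < m" "0 < w $ k"
    using nonneg_nonzero_sum_pos[OF w] sum_nonpos[of "{..<m}" "\<lambda>l. w $ l"]
    by (metis lessThan_iff not_less)
  have "0 < w $ k * (cmod (poly q (x k)))\<^sup>2"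
    using k q(3) by simp
  then have D: "0 < D"
    unfolding D_def using wnn k(1) by (intro sum_pos2[of _ k]) auto
  \<comment> \<open>All errors are finite here, so their maximum, being one of them, is
    real.\<close>
  have "Max ((\<lambda>l. sq_error F R (x l)) ` {..<m}) \<in> (\<lambda>l. sq_error F R (x l)) ` {..<m}"
    using k(1) by (intro Max_in) auto
  then obtain c where c: "Max ((\<lambda>l. sq_error F R (x l)) ` {..<m}) = ereal c"
    using err by auto
  have Ec: "E l \<le> c" if "l < m" for l
  proof -
    have "sq_error F R (x l) \<le> Max ((\<lambda>l. sq_error F R (x l)) ` {..<m})"
      using that by (intro Max_ge) auto
    then show ?thesis
      using err[OF that] c by simp
  qed
  have "(\<Sum>l<m. w $ l * node_residual s t F p q (x l)) \<le> (\<Sum>l<m. w $ l * ((cmod (poly q (x l)))\<^sup>2 * c))"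
    using Ec wnn by (intro sum_mono mult_left_mono) (auto simp: res intro: mult_left_mono)
  also have "\<dots> = c * D"
    by (simp add: D_def sum_distrib_left algebra_simps)
  finally have "(\<Sum>l<m. w $ l * node_residual s t F p q (x l)) / D \<le> c"
    using D by (simp add: field_simps)
  then have "dual_fun s t n d m x F w \<le> c"
    using dual_fun_le_quotient[OF w pq, of x F] D unfolding D_def by linarith
  then show ?thesis
    using c by simp
qed

subsection \<open>The matrix form\<close>

text \<open>Membership in the span gives coefficients on the basis polynomials; injectivity of
  \<open>\<psi>\<close> turns them into coefficients indexed by position.\<close>

lemma poly_basis_iff_combination:
  assumes "poly_basis k \<psi>"
  shows "p \<in> polys_le k \<longleftrightarrow> (\<exists>a\<in>carrier_vec (k + 1). p = (\<Sum>c<k + 1. Polynomial.smult (a $ c) (\<psi> c)))"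
proof
  assume "p \<in> polys_le k"
  then have "p \<in> poly_vs.span (\<psi> ` {..k})"
    using assms by (simp add: poly_basis_def)
  then obtain f where "p = (\<Sum>v\<in>\<psi> ` {..k}. Polynomial.smult (f v) v)"
    by (auto simp: poly_vs.span_finite)
  also have "\<dots> = (\<Sum>c<k + 1. Polynomial.smult (f (\<psi> c)) (\<psi> c))"
    using assms by (simp add: poly_basis_def sum.reindex lessThan_Suc_atMost)
  also have "\<dots> = (\<Sum>c<k + 1. Polynomial.smult (Matrix.vec (k + 1) (\<lambda>c. f (\<psi> c)) $ c) (\<psi> c))"
    by (intro sum.cong) auto
  finally show "\<exists>a\<in>carrier_vec (k + 1). p = (\<Sum>c<k + 1. Polynomial.smult (a $ c) (\<psi> c))"
    by (intro bexI[of _ "Matrix.vec (k + 1) (\<lambda>c. f (\<psi> c))"]) auto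
next
  assume "\<exists>a\<in>carrier_vec (k + 1). p = (\<Sum>c<k + 1. Polynomial.smult (a $ c) (\<psi> c))"
  then obtain a where "p = (\<Sum>c<k + 1. Polynomial.smult (a $ c) (\<psi> c))"
    by blast
  then have "p \<in> poly_vs.span (\<psi> ` {..k})"
    by (simp only:) (intro poly_vs.span_sum poly_vs.span_scale poly_vs.span_base imageI, simp)
  then show "p \<in> polys_le k"
    using assms by (simp add: poly_basis_def)
qed

lemma basis_mat_carrier: "basis_mat m x k \<psi> \<in> carrier_mat m (k + 1)"
  by (simp add: basis_mat_def)

lemma basis_mat_mult:
  assumes "a \<in> carrier_vec (k + 1)" "l < m"
  shows "(basis_mat m x k \<psi> *\<^sub>v a) $ l = poly (\<Sum>c<k + 1. Polynomial.smult (a $ c) (\<psi> c)) (x l)"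
  using assms by (simp add: basis_mat_def scalar_prod_def poly_sum atLeast0LessThan mult.commute del: sum.lessThan_Suc)

section \<open>Diagonal weights and norms\<close>

lemma mat_diag_mult_vec:
  assumes "v \<in> carrier_vec N" "i < N"
  shows "(mat_diag N c *\<^sub>v v) $ i = c i * v $ i"
proof -
  have "(mat_diag N c *\<^sub>v v) $ i = (\<Sum>j<N. (if i = j then c j else 0) * v $ j)"
    using assms by (simp add: mat_diag_def scalar_prod_def atLeast0LessThan)
  also have "\<dots> = (\<Sum>j<N. if i = j then c j * v $ j else 0)"
    by (intro sum.cong) auto
  finally show ?thesis
    using assms by simp
qed

lemma vec_norm2_nonneg: "0 \<le> vec_norm2 v"
  by (simp add: vec_norm2_def)

lemma vec_norm2_mat_diag:
  assumes "v \<in> carrier_vec N"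
  shows "(vec_norm2 (mat_diag N c *\<^sub>v v))\<^sup>2 = (\<Sum>i<N. (cmod (c i))\<^sup>2 * (cmod (v $ i))\<^sup>2)"
proof -
  have "dim_vec (mat_diag N c *\<^sub>v v) = N"
    by (simp add: mat_diag_def)
  then have "(vec_norm2 (mat_diag N c *\<^sub>v v))\<^sup>2 = (\<Sum>i<N. (cmod ((mat_diag N c *\<^sub>v v) $ i))\<^sup>2)"
    by (simp add: vec_norm2_def L2_set_def sum_nonneg)
  also have "\<dots> = (\<Sum>i<N. (cmod (c i))\<^sup>2 * (cmod (v $ i))\<^sup>2)"
    using assms by (intro sum.cong) (simp_all add: mat_diag_mult_vec norm_mult power_mult_distrib)
  finally show ?thesis .
qed

lemma cmod_csqrt_power2: "0 \<le> r \<Longrightarrow> (cmod (csqrt (complex_of_real r)))\<^sup>2 = r"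
  by (metis abs_of_nonneg norm_of_real norm_power power2_csqrt)

lemma diag_sqrt_weight_mat:
  "diag_sqrt (weight_mat m w) = mat_diag m (\<lambda>l. csqrt (complex_of_real (w $ l)))"
  by (intro eq_matI) (auto simp: diag_sqrt_def weight_mat_def mat_diag_def)

text \<open>Quotient and remainder of an index by \<open>m\<close> are its block and its node. Only
  entries where both agree can be nonzero, and \<open>csqrt\<close> maps the remaining zeros to
  zero.\<close>

lemma diag_sqrt_kronecker_weight_mat:
  "diag_sqrt (kronecker (1\<^sub>m g) (weight_mat m w))
     = mat_diag (g * m) (\<lambda>i. csqrt (complex_of_real (w $ (i mod m))))"
proof (intro eq_matI)
  fix i j
  assume "i < dim_row (mat_diag (g * m) (\<lambda>i. csqrt (complex_of_real (w $ (i mod m)))))"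
    and "j < dim_col (mat_diag (g * m) (\<lambda>i. csqrt (complex_of_real (w $ (i mod m)))))"
  then have ij: "i < g * m" "j < g * m"
    by (simp_all add: mat_diag_def)
  then have m: "0 < m"
    by (cases m) auto
  have "i div m < g" "j div m < g"
    using ij by (simp_all add: less_mult_imp_div_less)
  moreover have "i = j" if "i div m = j div m" "i mod m = j mod m"
    using that by (metis div_mult_mod_eq)
  ultimately show "diag_sqrt (kronecker (1\<^sub>m g) (weight_mat m w)) $$ (i,j)
      = mat_diag (g * m) (\<lambda>i. csqrt (complex_of_real (w $ (i mod m)))) $$ (i,j)"
    using ij m by (auto simp: diag_sqrt_def kronecker_def weight_mat_def mat_diag_def)
qed (auto simp: diag_sqrt_def kronecker_def weight_mat_def mat_diag_def)

section \<open>Stacked vectors and block matrices\<close>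

abbreviation stack_vecs :: "'a Matrix.vec list \<Rightarrow> 'a Matrix.vec" where
  "stack_vecs vs \<equiv> foldr (@\<^sub>v) vs vNil"

lemma stack_vecs_carrier:
  assumes "\<And>z. z \<in> set zs \<Longrightarrow> V z \<in> carrier_vec (k z)"
  shows "stack_vecs (map V zs) \<in> carrier_vec (sum_list (map k zs))"
  using assms by (induction zs) auto

text \<open>Repeatedly splitting off a prefix of length \<open>k z\<close> yields the blocks.
  Distinctness of the list keeps the update at \<open>z\<close> from overwriting a later
  block.\<close>

lemma stack_vecs_surj:
  assumes "distinct zs" "a \<in> carrier_vec (sum_list (map k zs))"
  shows "\<exists>A. (\<forall>z\<in>set zs. A z \<in> carrier_vec (k z)) \<and> a = stack_vecs (map A zs)"
  using assms
proof (induction zs arbitrary: a)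
  case Nil
  then show ?case
    by auto
next
  case (Cons z zs)
  let ?h = "vec_first a (k z)" and ?r = "vec_last a (sum_list (map k zs))"
  have a: "?h @\<^sub>v ?r = a"
    using Cons.prems by (intro vec_first_last_append) simp
  obtain A where A: "\<forall>z\<in>set zs. A z \<in> carrier_vec (k z)" "?r = stack_vecs (map A zs)"
    using Cons.IH[of ?r] Cons.prems by auto
  have "map (A(z := ?h)) (z # zs) = ?h # map A zs"
    using Cons.prems by auto
  then have "stack_vecs (map (A(z := ?h)) (z # zs)) = a"
    by (simp only: foldr.simps o_apply A(2)[symmetric] a)
  moreover have "\<forall>z'\<in>set (z # zs). (A(z := ?h)) z' \<in> carrier_vec (k z')"
    using A(1) by auto
  ultimately show ?case
    by metis
qed

lemma minus_append_vec:
  fixes v v' w w' :: "'a::minus Matrix.vec"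
  assumes "dim_vec v = dim_vec v'" "dim_vec w = dim_vec w'"
  shows "(v @\<^sub>v w) - (v' @\<^sub>v w') = (v - v') @\<^sub>v (w - w')"
  using assms by (intro eq_vecI) auto

text \<open>The stacked diagonal matrices all act on the same \<open>u\<close>, while the block
  diagonal matrix acts on each coefficient block separately, so the residual splits block by
  block.\<close>

lemma stacked_residual:
  fixes f :: "'z \<Rightarrow> nat \<Rightarrow> 'a::comm_ring_1"
  assumes u: "u \<in> carrier_vec m"
    and "\<And>z. z \<in> set zs \<Longrightarrow> B z \<in> carrier_mat m (k z)"
    and "\<And>z. z \<in> set zs \<Longrightarrow> A z \<in> carrier_vec (k z)"
  shows "foldr (@\<^sub>r) (map (\<lambda>z. mat_diag m (f z)) zs) (0\<^sub>m 0 m) *\<^sub>v u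
           - diag_block_mat (map B zs) *\<^sub>v stack_vecs (map A zs)
         = stack_vecs (map (\<lambda>z. mat_diag m (f z) *\<^sub>v u - B z *\<^sub>v A z) zs)"
  using assms(2,3)
proof (induction zs)
  case Nil
  show ?case
    by (intro eq_vecI) auto
next
  case (Cons z zs)
  let ?D = "foldr (@\<^sub>r) (map (\<lambda>z. mat_diag m (f z)) zs) (0\<^sub>m 0 m)"
  let ?T = "diag_block_mat (map B zs)"
  let ?a = "stack_vecs (map A zs)"
  let ?N = "sum_list (map k zs)" and ?M = "length zs * m"
  have D: "?D \<in> carrier_mat ?M m"
    by (induction zs) auto
  \<comment> \<open>The dimensions of the tail matrices are needed for the four-block product
    below.\<close>
  have "map dim_row (map B zs) = map (\<lambda>_. m) zs" "map dim_col (map B zs) = map k zs"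
    using Cons.prems by auto
  then have sums: "sum_list (map dim_row (map B zs)) = ?M" "sum_list (map dim_col (map B zs)) = ?N"
    by (simp_all only: sum_list_triv of_nat_id)
  have T: "?T \<in> carrier_mat ?M ?N"
    using sums by (intro carrier_matI) (simp_all only: dim_diag_block_mat)
  have B: "B z \<in> carrier_mat m (k z)" and A: "A z \<in> carrier_vec (k z)"
    using Cons.prems by auto
  have a: "?a \<in> carrier_vec ?N"
    using Cons.prems by (intro stack_vecs_carrier) auto
  have "foldr (@\<^sub>r) (map (\<lambda>z. mat_diag m (f z)) (z # zs)) (0\<^sub>m 0 m) *\<^sub>v u
      = (mat_diag m (f z) *\<^sub>v u) @\<^sub>v (?D *\<^sub>v u)"
    using mat_mult_append[OF mat_diag_dim D u] by simp
  moreover have "diag_block_mat (map B (z # zs)) *\<^sub>v stack_vecs (map A (z # zs))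
      = (B z *\<^sub>v A z) @\<^sub>v (?T *\<^sub>v ?a)"
  proof -
    have "dim_row (B z) = m" "dim_col (B z) = k z" "dim_row ?T = ?M" "dim_col ?T = ?N"
      using B T by auto
    then have "diag_block_mat (map B (z # zs)) *\<^sub>v stack_vecs (map A (z # zs))
        = four_block_mat (B z) (0\<^sub>m m ?N) (0\<^sub>m ?M (k z)) ?T *\<^sub>v (A z @\<^sub>v ?a)"
      by (simp add: Let_def)
    also have "\<dots> = (B z *\<^sub>v A z + 0\<^sub>m m ?N *\<^sub>v ?a) @\<^sub>v (0\<^sub>m ?M (k z) *\<^sub>v A z + ?T *\<^sub>v ?a)"
      by (rule four_block_mat_mult_vec[OF B _ _ T A a]) auto
    also have "0\<^sub>m m ?N *\<^sub>v ?a = 0\<^sub>v m"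
      using a by (intro eq_vecI) auto
    also have "0\<^sub>m ?M (k z) *\<^sub>v A z = 0\<^sub>v ?M"
      using A by (intro eq_vecI) auto
    also have "B z *\<^sub>v A z + 0\<^sub>v m = B z *\<^sub>v A z"
      using mult_mat_vec_carrier[OF B A] by simp
    also have "0\<^sub>v ?M + ?T *\<^sub>v ?a = ?T *\<^sub>v ?a"
      using mult_mat_vec_carrier[OF T a] by simp
    finally show ?thesis .
  qed
  moreover have "?D *\<^sub>v u - ?T *\<^sub>v ?a = stack_vecs (map (\<lambda>z. mat_diag m (f z) *\<^sub>v u - B z *\<^sub>v A z) zs)"
    using Cons by simp
  ultimately show ?case
    using B D T by (simp add: minus_append_vec mat_diag_def)
qed

text \<open>\<open>h\<close> receives the position within a block, so that node weights can repeat
  across blocks. Peeling off the first block shifts indices by \<open>m\<close> and preserves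
  remainders.\<close>

lemma sum_stack_vecs:
  fixes h :: "nat \<Rightarrow> 'a \<Rightarrow> 'b::comm_monoid_add"
  assumes "\<And>z. z \<in> set zs \<Longrightarrow> V z \<in> carrier_vec m"
  shows "(\<Sum>i<length zs * m. h (i mod m) (stack_vecs (map V zs) $ i)) = (\<Sum>z\<leftarrow>zs. \<Sum>l<m. h l (V z $ l))"
  using assms
proof (induction zs)
  case (Cons z zs)
  let ?v = "stack_vecs (map V zs)" and ?N = "length zs * m"
  have V: "dim_vec (V z) = m"
    using Cons.prems by auto
  have v: "dim_vec ?v = ?N"
    using stack_vecs_carrier[of zs V "\<lambda>_. m"] Cons.prems by (auto simp: sum_list_triv)
  have "(\<Sum>i<m + ?N. h (i mod m) ((V z @\<^sub>v ?v) $ i))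
      = (\<Sum>i<m. h (i mod m) ((V z @\<^sub>v ?v) $ i)) + (\<Sum>i<?N. h ((i + m) mod m) ((V z @\<^sub>v ?v) $ (i + m)))"
    using sum.atLeastLessThan_concat[of 0 m "m + ?N" "\<lambda>i. h (i mod m) ((V z @\<^sub>v ?v) $ i)"]
      sum.shift_bounds_nat_ivl[of "\<lambda>i. h (i mod m) ((V z @\<^sub>v ?v) $ i)" 0 m ?N]
    by (simp add: atLeast0LessThan add.commute)
  also have "\<dots> = (\<Sum>l<m. h l (V z $ l)) + (\<Sum>i<?N. h (i mod m) (?v $ i))"
    using V v by (intro arg_cong2[of _ _ _ _ "(+)"] sum.cong) auto
  finally show ?case
    using Cons by simp
qed simp

lemma set_colwise_pairs: "set (colwise_pairs s t) = {..<s} \<times> {..<t}"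
  by (auto simp: colwise_pairs_def)

lemma distinct_colwise_pairs: "distinct (colwise_pairs s t)"
proof (induction t)
  case (Suc t)
  have "colwise_pairs s (Suc t) = colwise_pairs s t @ map (\<lambda>i. (i,t)) [0..<s]"
    by (simp add: colwise_pairs_def)
  then show ?case
    using Suc by (auto simp: set_colwise_pairs distinct_map inj_on_def)
qed (simp add: colwise_pairs_def)

lemma length_colwise_pairs: "length (colwise_pairs s t) = s * t"
  using distinct_card[OF distinct_colwise_pairs[of s t]] by (simp add: set_colwise_pairs card_cartesian_product)

lemma sum_list_colwise_pairs:
  fixes h :: "nat \<times> nat \<Rightarrow> 'a::comm_monoid_add"
  shows "(\<Sum>z\<leftarrow>colwise_pairs s t. h z) = (\<Sum>i<s. \<Sum>j<t. h (i,j))"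
  using distinct_colwise_pairs[of s t]
  by (simp add: sum_list_distinct_conv_sum_set set_colwise_pairs sum.cartesian_product)

section \<open>Comparison of the two formulations\<close>

text \<open>Block \<open>(i,j)\<close> of the stacked residual lists the linearized errors of that
  entry at the nodes. The squared moduli of the root weights restore \<open>w\<close>, and
  exchanging the sums collects the entries at each node.\<close>

lemma dual_matrix_objective:
  fixes A :: "nat \<times> nat \<Rightarrow> complex Matrix.vec"
  assumes w: "w \<in> nonneg_nonzero m"
    and b: "b \<in> carrier_vec (d + 1)"
    and A: "\<And>i j. i < s \<Longrightarrow> j < t \<Longrightarrow> A (i,j) \<in> carrier_vec (n i j + 1)"
    and q: "q = (\<Sum>c<d + 1. Polynomial.smult (b $ c) (\<phi> c))"
    and p: "\<And>i j. i < s \<Longrightarrow> j < t \<Longrightarrow> p i j = (\<Sum>c<n i j + 1. Polynomial.smult (A (i,j) $ c) (\<psi> i j c))"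
  shows "(vec_norm2 (diag_sqrt (kronecker (1\<^sub>m (s * t)) (weight_mat m w)) *\<^sub>v
            (data_stack s t m x F *\<^sub>v (basis_mat m x d \<phi> *\<^sub>v b)
             - Theta_mat s t n m x \<psi> *\<^sub>v stack_vecs (map A (colwise_pairs s t)))))\<^sup>2
         = (\<Sum>l<m. w $ l * node_residual s t F p q (x l))"
proof -
  let ?zs = "colwise_pairs s t"
  let ?u = "basis_mat m x d \<phi> *\<^sub>v b"
  define f where "f = (\<lambda>z l. F (x l) $$ z)"
  define B where "B = (\<lambda>(i,j). basis_mat m x (n i j) (\<psi> i j))"
  define k where "k = (\<lambda>(i,j). n i j + 1)"
  define V where "V z = mat_diag m (f z) *\<^sub>v ?u - B z *\<^sub>v A z" for z
  have u: "?u \<in> carrier_vec m"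
    using mult_mat_vec_carrier[OF basis_mat_carrier b] .
  have B: "B z \<in> carrier_mat m (k z)" if "z \<in> set ?zs" for z
    using basis_mat_carrier by (auto simp: B_def k_def split: prod.split)
  have Ak: "A z \<in> carrier_vec (k z)" if "z \<in> set ?zs" for z
    using that A by (auto simp: k_def set_colwise_pairs)
  have V: "V z \<in> carrier_vec m" if "z \<in> set ?zs" for z
    unfolding V_def using mult_mat_vec_carrier[OF B Ak, OF that that] mult_mat_vec_carrier[OF mat_diag_dim u]
    by simp
  have entry: "V (i,j) $ l = F (x l) $$ (i,j) * poly q (x l) - poly (p i j) (x l)"
    if "i < s" "j < t" "l < m" for i j l
  proof -
    have "dim_vec (B (i,j) *\<^sub>v A (i,j)) = m"
      by (simp add: B_def basis_mat_def)
    then show ?thesis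
      using that A[OF that(1,2)] p[OF that(1,2)] q b u
      by (simp add: V_def f_def B_def mat_diag_mult_vec basis_mat_mult
          del: sum.lessThan_Suc index_mult_mat_vec)
  qed
  have "data_stack s t m x F = foldr (@\<^sub>r) (map (\<lambda>z. mat_diag m (f z)) ?zs) (0\<^sub>m 0 m)"
    by (simp add: data_stack_def f_def split_def)
  moreover have "Theta_mat s t n m x \<psi> = diag_block_mat (map B ?zs)"
    by (simp add: Theta_mat_def B_def)
  ultimately have res: "data_stack s t m x F *\<^sub>v ?u - Theta_mat s t n m x \<psi> *\<^sub>v stack_vecs (map A ?zs)
      = stack_vecs (map V ?zs)"
    unfolding V_def by (simp only: stacked_residual[OF u B Ak])
  have "stack_vecs (map V ?zs) \<in> carrier_vec (s * t * m)"
    using stack_vecs_carrier[of ?zs V "\<lambda>_. m"] V by (simp add: sum_list_triv length_colwise_pairs)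
  then have "(vec_norm2 (diag_sqrt (kronecker (1\<^sub>m (s * t)) (weight_mat m w)) *\<^sub>v stack_vecs (map V ?zs)))\<^sup>2
      = (\<Sum>i<s * t * m. (cmod (csqrt (complex_of_real (w $ (i mod m)))))\<^sup>2 * (cmod (stack_vecs (map V ?zs) $ i))\<^sup>2)"
    by (simp only: diag_sqrt_kronecker_weight_mat vec_norm2_mat_diag)
  also have "\<dots> = (\<Sum>z\<leftarrow>?zs. \<Sum>l<m. (cmod (csqrt (complex_of_real (w $ l))))\<^sup>2 * (cmod (V z $ l))\<^sup>2)"
    using sum_stack_vecs[of ?zs V m "\<lambda>l y. (cmod (csqrt (complex_of_real (w $ l))))\<^sup>2 * (cmod y)\<^sup>2"] V
    by (simp add: length_colwise_pairs)
  also have "\<dots> = (\<Sum>i<s. \<Sum>j<t. \<Sum>l<m. w $ l * (cmod (F (x l) $$ (i,j) * poly q (x l) - poly (p i j) (x l)))\<^sup>2)"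
    unfolding sum_list_colwise_pairs
    using nonneg_nonzero_nonneg[OF w] by (intro sum.cong refl) (simp add: entry cmod_csqrt_power2)
  also have "\<dots> = (\<Sum>l<m. w $ l * node_residual s t F p q (x l))"
    unfolding node_residual_def sum_distrib_left
    by (subst sum.swap[where A = "{..<m}" and B = "{..<s}"], rule sum.cong[OF refl], rule sum.swap)
  finally show ?thesis
    by (simp only: res)
qed

text \<open>The squared norm is the normalizing sum, and a nonnegative number is 1 exactly when its
  square is.\<close>

lemma dual_matrix_constraint:
  assumes w: "w \<in> nonneg_nonzero m" and b: "b \<in> carrier_vec (d + 1)"
    and q: "q = (\<Sum>c<d + 1. Polynomial.smult (b $ c) (\<phi> c))"
  shows "vec_norm2 (diag_sqrt (weight_mat m w) *\<^sub>v (basis_mat m x d \<phi> *\<^sub>v b)) = 1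
     \<longleftrightarrow> (\<Sum>l<m. w $ l * (cmod (poly q (x l)))\<^sup>2) = 1"
proof -
  let ?v = "diag_sqrt (weight_mat m w) *\<^sub>v (basis_mat m x d \<phi> *\<^sub>v b)"
  have "(vec_norm2 ?v)\<^sup>2
      = (\<Sum>l<m. (cmod (csqrt (complex_of_real (w $ l))))\<^sup>2 * (cmod ((basis_mat m x d \<phi> *\<^sub>v b) $ l))\<^sup>2)"
    unfolding diag_sqrt_weight_mat
    by (rule vec_norm2_mat_diag[OF mult_mat_vec_carrier[OF basis_mat_carrier b]])
  also have "\<dots> = (\<Sum>l<m. w $ l * (cmod (poly q (x l)))\<^sup>2)"
    using nonneg_nonzero_nonneg[OF w]
    by (intro sum.cong) (simp_all add: basis_mat_mult[OF b] q cmod_csqrt_power2 del: sum.lessThan_Suc)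
  finally have "(vec_norm2 ?v)\<^sup>2 = (\<Sum>l<m. w $ l * (cmod (poly q (x l)))\<^sup>2)" .
  then show ?thesis
    using vec_norm2_nonneg[of ?v] by (metis power2_eq_1_iff one_power2 le_minus_one_simps(3) )
qed

text \<open>Coefficient vectors and polynomials of bounded degree correspond in both directions, so
  both parametrizations reach the same objective values; attainment of the matrix minimum follows
  from the polynomial one.\<close>

lemma dual_matrix_values_eq:
  assumes w: "w \<in> nonneg_nonzero m"
    and psi: "\<forall>i<s. \<forall>j<t. poly_basis (n i j) (\<psi> i j)" and phi: "poly_basis d \<phi>"
  shows "dual_matrix_values s t n d m x F \<psi> \<phi> w = dual_values s t n d m x F w"
proof (intro equalityI subsetI)
  let ?zs = "colwise_pairs s t"
  let ?k = "\<lambda>(i,j). n i j + 1"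
  \<comment> \<open>The coefficient count is rewritten as the total length of the blocks in
    column-wise order.\<close>
  have N: "(\<Sum>i<s. \<Sum>j<t. n i j + 1) = sum_list (map ?k ?zs)"
    unfolding sum_list_colwise_pairs by simp
  {
    fix v assume "v \<in> dual_matrix_values s t n d m x F \<psi> \<phi> w"
    then obtain a b where a: "a \<in> carrier_vec (sum_list (map ?k ?zs))" and b: "b \<in> carrier_vec (d + 1)"
      and norm1: "vec_norm2 (diag_sqrt (weight_mat m w) *\<^sub>v (basis_mat m x d \<phi> *\<^sub>v b)) = 1"
      and v: "v = (vec_norm2 (diag_sqrt (kronecker (1\<^sub>m (s * t)) (weight_mat m w)) *\<^sub>v
            (data_stack s t m x F *\<^sub>v (basis_mat m x d \<phi> *\<^sub>v b) - Theta_mat s t n m x \<psi> *\<^sub>v a)))\<^sup>2"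
      unfolding dual_matrix_values_def Let_def N by blast
    \<comment> \<open>The long vector is cut into one coefficient block per matrix entry.\<close>
    obtain A where A: "\<forall>z\<in>set ?zs. A z \<in> carrier_vec (?k z)" and aA: "a = stack_vecs (map A ?zs)"
      using stack_vecs_surj[OF distinct_colwise_pairs a] by blast
    define q where "q = (\<Sum>c<d + 1. Polynomial.smult (b $ c) (\<phi> c))"
    define p where "p i j = (\<Sum>c<n i j + 1. Polynomial.smult (A (i,j) $ c) (\<psi> i j c))" for i j
    have A': "A (i,j) \<in> carrier_vec (n i j + 1)" if "i < s" "j < t" for i j
      using A that by (auto simp: set_colwise_pairs)
    have "p i j \<in> polys_le (n i j)" if "i < s" "j < t" for i j
      using psi that A'[OF that] poly_basis_iff_combination[of "n i j" "\<psi> i j" "p i j"]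
      unfolding p_def by blast
    moreover have "q \<in> polys_le d"
      using b poly_basis_iff_combination[OF phi, of q] unfolding q_def by blast
    moreover have "(\<Sum>l<m. w $ l * (cmod (poly q (x l)))\<^sup>2) = 1"
      using norm1 dual_matrix_constraint[OF w b q_def] by blast
    moreover have "v = (\<Sum>l<m. w $ l * node_residual s t F p q (x l))"
      unfolding v aA using A' p_def by (intro dual_matrix_objective[OF w b _ q_def])
    ultimately show "v \<in> dual_values s t n d m x F w"
      unfolding dual_values_residual by blast
  next
    fix v assume "v \<in> dual_values s t n d m x F w"
    then obtain p q where p: "\<forall>i<s. \<forall>j<t. p i j \<in> polys_le (n i j)" and q: "q \<in> polys_le d"
      and norm1: "(\<Sum>l<m. w $ l * (cmod (poly q (x l)))\<^sup>2) = 1"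
      and v: "v = (\<Sum>l<m. w $ l * node_residual s t F p q (x l))"
      unfolding dual_values_residual by blast
    obtain b where b: "b \<in> carrier_vec (d + 1)" and qb: "q = (\<Sum>c<d + 1. Polynomial.smult (b $ c) (\<phi> c))"
      using q poly_basis_iff_combination[OF phi] by blast
    have "\<forall>z\<in>set ?zs. \<exists>a. a \<in> carrier_vec (?k z) \<and>
        p (fst z) (snd z) = (\<Sum>c<?k z. Polynomial.smult (a $ c) (\<psi> (fst z) (snd z) c))"
    proof
      fix z assume "z \<in> set ?zs"
      then obtain i j where z: "z = (i,j)" "i < s" "j < t"
        by (auto simp: set_colwise_pairs)
      then show "\<exists>a. a \<in> carrier_vec (?k z) \<and>
          p (fst z) (snd z) = (\<Sum>c<?k z. Polynomial.smult (a $ c) (\<psi> (fst z) (snd z) c))"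
        using p poly_basis_iff_combination[OF psi[rule_format, OF z(2,3)], of "p i j"]
        unfolding z(1) prod.case fst_conv snd_conv by blast
    qed
    \<comment> \<open>Coefficients are chosen separately for each entry and stacked
      afterwards.\<close>
    from bchoice[OF this] obtain A where A: "\<forall>z\<in>set ?zs. A z \<in> carrier_vec (?k z) \<and>
        p (fst z) (snd z) = (\<Sum>c<?k z. Polynomial.smult (A z $ c) (\<psi> (fst z) (snd z) c))"
      by blast
    have A': "A (i,j) \<in> carrier_vec (n i j + 1)"
      and pA: "p i j = (\<Sum>c<n i j + 1. Polynomial.smult (A (i,j) $ c) (\<psi> i j c))" if "i < s" "j < t" for i j
      using bspec[OF A, of "(i,j)"] that by (simp_all add: set_colwise_pairs del: sum.lessThan_Suc)
    have obj: "(vec_norm2 (diag_sqrt (kronecker (1\<^sub>m (s * t)) (weight_mat m w)) *\<^sub>v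
            (data_stack s t m x F *\<^sub>v (basis_mat m x d \<phi> *\<^sub>v b)
             - Theta_mat s t n m x \<psi> *\<^sub>v stack_vecs (map A ?zs))))\<^sup>2
        = (\<Sum>l<m. w $ l * node_residual s t F p q (x l))"
      using A' pA by (intro dual_matrix_objective[OF w b _ qb])
    have "stack_vecs (map A ?zs) \<in> carrier_vec (sum_list (map ?k ?zs))"
      using A by (intro stack_vecs_carrier) blast
    moreover have "vec_norm2 (diag_sqrt (weight_mat m w) *\<^sub>v (basis_mat m x d \<phi> *\<^sub>v b)) = 1"
      using norm1 dual_matrix_constraint[OF w b qb] by blast
    ultimately show "v \<in> dual_matrix_values s t n d m x F \<psi> \<phi> w"
      unfolding v obj[symmetric] dual_matrix_values_def Let_def N
      using b by blast
  }
qed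

section \<open>Attainment, maximum and weak duality combined\<close>

theorem theorem2p3:
  fixes s t m d :: nat
    and n :: "nat \<Rightarrow> nat \<Rightarrow> nat"
    and x :: "nat \<Rightarrow> complex"
    and F :: "complex \<Rightarrow> complex mat"
    and \<psi> :: "nat \<Rightarrow> nat \<Rightarrow> nat \<Rightarrow> complex poly"
    and \<phi> :: "nat \<Rightarrow> complex poly"
  assumes "s \<ge> 1" and "t \<ge> 1"
    and "inj_on x {..<m}"
    and "\<forall>i<s. \<forall>j<t. m \<ge> n i j + d + 2"
    and "\<forall>l<m. F (x l) \<in> carrier_mat s t"
    and "\<forall>i<s. \<forall>j<t. poly_basis (n i j) (\<psi> i j)"
    and "poly_basis d \<phi>"
  shows "(\<forall>w \<in> nonneg_nonzero m.
            attained_min (dual_values s t n d m x F w) (dual_fun s t n d m x F w) \<and>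
            attained_min (dual_matrix_values s t n d m x F \<psi> \<phi> w) (dual_fun s t n d m x F w)) \<and>
         (\<exists>M. attained_max (dual_fun s t n d m x F ` prob_simplex m) M \<and>
              (SUP w \<in> nonneg_nonzero m. ereal (dual_fun s t n d m x F w)) = ereal M \<and>
              ereal M \<le> eta_inf s t n d m x F)"
proof (intro conjI ballI)
  fix w assume w: "w \<in> nonneg_nonzero m"
  show min: "attained_min (dual_values s t n d m x F w) (dual_fun s t n d m x F w)"
    by (rule dual_fun_attained[OF assms(3) w])
  show "attained_min (dual_matrix_values s t n d m x F \<psi> \<phi> w) (dual_fun s t n d m x F w)"
    unfolding dual_matrix_values_eq[OF w assms(6,7)] by (rule min)
next
  \<comment> \<open>The index pair \<open>(0,0)\<close> exists, and its degree condition makes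
    \<open>m\<close> at least 2.\<close>
  have "0 < m"
    using assms(1,2,4) by fastforce
  then obtain w where w: "w \<in> prob_simplex m"
    and max: "\<And>u. u \<in> prob_simplex m \<Longrightarrow> dual_fun s t n d m x F u \<le> dual_fun s t n d m x F w"
    by (rule dual_fun_attains_max[OF assms(3)]) blast
  then have w': "w \<in> nonneg_nonzero m"
    using prob_simplex_nonneg_nonzero by blast
  let ?M = "dual_fun s t n d m x F w"
  have "attained_max (dual_fun s t n d m x F ` prob_simplex m) ?M"
    using w max by (auto simp: attained_max_def)
  moreover have "(SUP u \<in> nonneg_nonzero m. ereal (dual_fun s t n d m x F u)) = ereal ?M"
  \<comment> \<open>Normalization reduces the upper bound to the simplex; the maximizer itself
    belongs to the larger weight set, which gives the other inequality.\<close>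
  proof (intro antisym SUP_least SUP_upper w')
    fix u assume u: "u \<in> nonneg_nonzero m"
    obtain u' where "u' \<in> prob_simplex m" "dual_fun s t n d m x F u \<le> dual_fun s t n d m x F u'"
      by (rule dual_fun_le_normalized[OF assms(3) u])
    then show "ereal (dual_fun s t n d m x F u) \<le> ereal ?M"
      using max by fastforce
  qed
  \<comment> \<open>The bound at the fixed weight \<open>w\<close> holds for every admissible
    rational matrix, hence for the infimum of the maximal errors.\<close>
  moreover have "ereal ?M \<le> eta_inf s t n d m x F"
    unfolding eta_inf_def by (intro INF_greatest dual_fun_le_max_error[OF w' assms(5)])
  ultimately show "\<exists>M. attained_max (dual_fun s t n d m x F ` prob_simplex m) M \<and>
              (SUP w \<in> nonneg_nonzero m. ereal (dual_fun s t n d m x F w)) = ereal M \<and>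
              ereal M \<le> eta_inf s t n d m x F"
    by blast
qed

end
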